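(* Consider a random dynamical system $S(\omega,x)=(\theta\omega,T_\omega x)$ on $\Omega\times X$ preserving $\nu=\mathbb{P}\otimes\mu_\omega$. Assume that the compact metric space $X$ has bounded local complexity, that the fiber measures $\mu_\omega$ depend in a Lipschitz way on $\omega$, that $\theta$ mixes stretched exponentially and that $S$ mixes stretched exponentially along the fibers. Then, for $\mathbb{P}$-almost every $\omega$, for $\mu_\omega^{\otimes2}$-almost every $(x,y)$, $$\liminf_{n\to\infty}\frac{-\log m_n^{0}(\omega;x,y)}{\log n}\ge\frac{1}{\overline{D}_2^{\mathrm{qu}}},$$ where $m_n^0(\omega;x,y)=\min_{0\le i<n}d(T_\omega^ix,T_\omega^iy)$.
   Context: Random dynamical system: $\Omega$ is a compact metric space with a probability measure $\mathbb{P}$, and $\theta:\Omega\to\Omega$ is invertible and preserves $\mathbb{P}$. $(X,d)$ is a metric space and, for each $\omega\in\Omega$, $T_\omega:X\to X$ is measurable, such that the skew product $S(\omega,x)=(\theta\omega,T_\omega x)$ is measurable and preserves a probability measure $\nu$ on $\Omega\times X$ whose marginal on $\Omega$ is $\mathbb{P}$. Write $T_\omega^n=T_{\theta^{n-1}\omega}\circ\dots\circ T_\omega$. The measure $\nu$ is disintegrated above $\mathbb{P}$ into probability measures $\mu_\omega$ on $X$ depending measurably on $\omega$: $\int f\,d\nu=\int(\int f(\omega,x)\,d\mu_\omega(x))\,d\mathbb{P}(\omega)$, written $\nu=\mathbb{P}\otimes\mu_\omega$; one has $(T_\omega)_*\mu_\omega=\mu_{\theta\omega}$ for $\mathbb{P}$-a.e.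 $\omega$. Lipschitz norm: $\|f\|_{\mathrm{Lip}}=\|f\|_\infty+\mathrm{Lip}(f)$, where $\mathrm{Lip}(f)$ is the best Lipschitz constant of $f$. Bounded local complexity: a compact metric space $X$ has bounded local complexity if there is a constant $C_0$ such that, for every small enough $r>0$, there are $k(r)<\infty$ and points $x^{(r)}_1,\dots,x^{(r)}_{k(r)}\in X$ such that the balls $B(x^{(r)}_p,r)$, $1\le p\le k(r)$, cover $X$ and any point of $X$ belongs to at most $C_0$ of the balls $B(x^{(r)}_p,4r)$. Upper quenched correlation dimension: $$\overline{D}_2^{\mathrm{qu}}=\limsup_{r\to0}\frac{\log\int\int\mu_\omega(B(x,r))\,d\mu_\omega(x)\,d\mathbb{P}(\omega)}{\log r}.$$ The measures $\mu_\omega$ depend in a Lipschitz way on $\omega$: there is $C_1>0$ such that $|\int f\,d\mu_\omega-\int f\,d\mu_{\omega'}|\le C_1\|f\|_{\mathrm{Lip}}\,d(\omega,\omega')$ for every Lipschitz $f:X\to\mathbb{R}$ and all $\omega,\omega'\in\Omega$. $\theta$ mixes stretched exponentially: there are $c_2,C_2>0$ such that for all Lipschitz $f,g:\Omega\to\mathbb{R}$ and all $n\in\mathbb{N}$, $$\left|\int f\cdot g\circ\theta^n\,d\mathbb{P}-\left(\int f\,d\mathbb{P}\right)\left(\int g\,d\mathbb{P}\right)\right|\le C_2e^{-n^{c_2}}\|f\|_{\mathrm{Lip}}\|g\|_{\mathrm{Lip}}.$$ $S$ mixes stretched exponentially along the fibers: there are $c_3,C_3>0$ such that for all Lipschitz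 $f,g:X\to\mathbb{R}$, all $n\in\mathbb{N}$ and all $\omega\in\Omega$, $$\left|\int f\cdot g\circ T_\omega^n\,d\mu_\omega-\left(\int f\,d\mu_\omega\right)\left(\int g\,d\mu_{\theta^n\omega}\right)\right|\le C_3e^{-n^{c_3}}\|f\|_{\mathrm{Lip}}\|g\|_{\mathrm{Lip}}.$$ Conventions: $-\log0=+\infty$ and $1/0=+\infty$. *)

theory Defs
  imports "HOL-Probability.Probability"
begin

text \<open>
  The metric spaces \<open>\<Omega>\<close> and \<open>X\<close> are rendered as types of class
  \<^class>\<open>metric_space\<close>, with their Borel \<open>\<sigma>\<close>-algebras; \<open>B(x,r)\<close> is the open ball.
  In the locale, \<open>\<theta>\<close> is invertible in the measurable sense. Measurability of its inverse
  is automatic for a measurable bijection of a compact metric space (Lusin--Souslin).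
  The relation \<open>(T\<^sub>\<omega>)\<^sub>* \<mu>\<^sub>\<omega> = \<mu>\<^sub>\<theta>\<^sub>\<omega>\<close> almost everywhere is a
  consequence of the assumptions and is not assumed.
\<close>

locale random_dynamical_system =
  fixes P :: "'w::metric_space measure"
    and \<theta> :: "'w \<Rightarrow> 'w"
    and T :: "'w \<Rightarrow> 'x::metric_space \<Rightarrow> 'x"
    and \<nu> :: "('w \<times> 'x) measure"
    and \<mu> :: "'w \<Rightarrow> 'x measure"
  assumes compact_base: "compact (UNIV :: 'w set)"
    and prob_base: "prob_space P"
    and sets_base: "sets P = sets borel"
    and bij_base: "bij \<theta>"
    and measurable_base: "\<theta> \<in> borel \<rightarrow>\<^sub>M borel"
    and measurable_base_inv: "inv \<theta> \<in> borel \<rightarrow>\<^sub>M borel"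
    and invariant_base: "distr P P \<theta> = P"
    and measurable_fiber: "\<And>\<omega>. T \<omega> \<in> borel \<rightarrow>\<^sub>M borel"
    and measurable_skew:
      "(\<lambda>(\<omega>, x). (\<theta> \<omega>, T \<omega> x)) \<in> borel \<Otimes>\<^sub>M borel \<rightarrow>\<^sub>M borel \<Otimes>\<^sub>M borel"
    and prob_skew: "prob_space \<nu>"
    and sets_skew: "sets \<nu> = sets (borel \<Otimes>\<^sub>M borel)"
    and invariant_skew: "distr \<nu> \<nu> (\<lambda>(\<omega>, x). (\<theta> \<omega>, T \<omega> x)) = \<nu>"
    and marginal: "distr \<nu> P fst = P"
    and kernel: "\<mu> \<in> borel \<rightarrow>\<^sub>M prob_algebra borel"
    and disintegration:
      "\<And>f. f \<in> borel_measurable (borel \<Otimes>\<^sub>M borel) \<Longrightarrow>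
         (\<integral>\<^sup>+ z. f z \<partial>\<nu>) = (\<integral>\<^sup>+ \<omega>. (\<integral>\<^sup>+ x. f (\<omega>, x) \<partial>\<mu> \<omega>) \<partial>P)"

primrec fiber_iter ::
  "('w \<Rightarrow> 'w) \<Rightarrow> ('w \<Rightarrow> 'x \<Rightarrow> 'x) \<Rightarrow> nat \<Rightarrow> 'w \<Rightarrow> 'x \<Rightarrow> 'x" where
  "fiber_iter \<theta> T 0 \<omega> = id"
| "fiber_iter \<theta> T (Suc n) \<omega> = T ((\<theta> ^^ n) \<omega>) \<circ> fiber_iter \<theta> T n \<omega>"

definition lipschitz_fun :: "('a::metric_space \<Rightarrow> real) \<Rightarrow> bool" where
  "lipschitz_fun f \<longleftrightarrow> (\<exists>L. L-lipschitz_on UNIV f)"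

text \<open>The norm is meaningful for bounded Lipschitz functions; on a compact space every
  Lipschitz function is bounded.\<close>

definition lip_norm :: "('a::metric_space \<Rightarrow> real) \<Rightarrow> real" where
  "lip_norm f = (SUP x. \<bar>f x\<bar>) + Inf {L. L-lipschitz_on UNIV f}"

definition bounded_local_complexity :: "'a::metric_space set \<Rightarrow> bool" where
  "bounded_local_complexity X \<longleftrightarrow>
     (\<exists>C0::nat. \<forall>\<^sub>F r in at_right (0::real). \<exists>(k::nat) (c :: nat \<Rightarrow> 'a).
        c ` {1..k} \<subseteq> X \<and> X \<subseteq> (\<Union>p\<in>{1..k}. ball (c p) r) \<and>
        (\<forall>y\<in>X. card {p \<in> {1..k}. y \<in> ball (c p) (4 * r)} \<le> C0))"

definition lipschitz_fiber_measures :: "('w::metric_space \<Rightarrow> 'x::metric_space measure) \<Rightarrow> bool" where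
  "lipschitz_fiber_measures \<mu> \<longleftrightarrow>
     (\<exists>C>0. \<forall>f \<omega> \<omega>'. lipschitz_fun f \<longrightarrow>
        \<bar>(\<integral>x. f x \<partial>\<mu> \<omega>) - (\<integral>x. f x \<partial>\<mu> \<omega>')\<bar> \<le> C * lip_norm f * dist \<omega> \<omega>')"

definition mixes_stretched_exp :: "'w::metric_space measure \<Rightarrow> ('w \<Rightarrow> 'w) \<Rightarrow> bool" where
  "mixes_stretched_exp P \<theta> \<longleftrightarrow>
     (\<exists>c>0. \<exists>C>0. \<forall>f g. \<forall>n::nat. lipschitz_fun f \<longrightarrow> lipschitz_fun g \<longrightarrow>
        \<bar>(\<integral>\<omega>. f \<omega> * g ((\<theta> ^^ n) \<omega>) \<partial>P) - (\<integral>\<omega>. f \<omega> \<partial>P) * (\<integral>\<omega>. g \<omega> \<partial>P)\<bar>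
          \<le> C * exp (- (real n powr c)) * lip_norm f * lip_norm g)"

definition mixes_stretched_exp_fibers ::
  "('w \<Rightarrow> 'w) \<Rightarrow> ('w \<Rightarrow> 'x::metric_space \<Rightarrow> 'x) \<Rightarrow> ('w \<Rightarrow> 'x measure) \<Rightarrow> bool" where
  "mixes_stretched_exp_fibers \<theta> T \<mu> \<longleftrightarrow>
     (\<exists>c>0. \<exists>C>0. \<forall>f g \<omega>. \<forall>n::nat. lipschitz_fun f \<longrightarrow> lipschitz_fun g \<longrightarrow>
        \<bar>(\<integral>x. f x * g (fiber_iter \<theta> T n \<omega> x) \<partial>\<mu> \<omega>)
            - (\<integral>x. f x \<partial>\<mu> \<omega>) * (\<integral>x. g x \<partial>\<mu> ((\<theta> ^^ n) \<omega>))\<bar>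
          \<le> C * exp (- (real n powr c)) * lip_norm f * lip_norm g)"

text \<open>Logarithm on \<open>[0, \<infinity>)\<close> with \<open>log 0 = -\<infinity>\<close>. The companion convention
  \<open>1 / 0 = \<infinity>\<close> is the one of division on \<^typ>\<open>ereal\<close>.\<close>

definition elog :: "real \<Rightarrow> ereal" where
  "elog t = (if t = 0 then - \<infinity> else ereal (ln t))"

definition upper_quenched_corr_dim ::
  "'w measure \<Rightarrow> ('w \<Rightarrow> 'x::metric_space measure) \<Rightarrow> ereal" where
  "upper_quenched_corr_dim P \<mu> =
     Limsup (at_right 0)
       (\<lambda>r::real. elog (\<integral>\<omega>. (\<integral>x. measure (\<mu> \<omega>) (ball x r) \<partial>\<mu> \<omega>) \<partial>P) / ereal (ln r))"

text \<open>Only meaningful for \<open>n \<ge> 1\<close>.\<close>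

definition min_orbit_dist ::
  "('w \<Rightarrow> 'w) \<Rightarrow> ('w \<Rightarrow> 'x::metric_space \<Rightarrow> 'x) \<Rightarrow> nat \<Rightarrow> 'w \<Rightarrow> 'x \<Rightarrow> 'x \<Rightarrow> real" where
  "min_orbit_dist \<theta> T n \<omega> x y =
     Min ((\<lambda>i. dist (fiber_iter \<theta> T i \<omega> x) (fiber_iter \<theta> T i \<omega> y)) ` {..<n})"

end

theory Submission
  imports Defs
begin

text \<open>
  Write \<open>I(r) = \<integral>\<integral> \<mu>\<^sub>\<omega>(B(x, r)) d\<mu>\<^sub>\<omega>(x) dP(\<omega>)\<close> and let \<open>s\<close> be larger than the upper quenched
  correlation dimension, so that \<open>I(r) \<ge> r\<^sup>s\<close> for small \<open>r\<close>. Draw \<open>\<omega>\<close> from \<open>P\<close> and then \<open>x\<close> and \<open>y\<close>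
  independently from \<open>\<mu>\<^sub>\<omega>\<close>. By invariance, at each time the two orbits are within \<open>r\<close> of each other
  with probability \<open>I(r)\<close>. Among \<open>N\<close> times the expected number of encounters is at least \<open>N r\<^sup>s\<close>, which
  is large when \<open>N\<close> is a power of \<open>1/r\<close> with an exponent above \<open>s\<close>; if the encounters decorrelate, then
  some encounter is very likely.

  Decorrelation comes from the second moment. The indicator of \<open>{d(x, y) < r}\<close> is replaced by
  \<open>\<Sum>\<^sub>p \<rho>\<^sub>p(x) \<rho>\<^sub>p(y)\<close> with Lipschitz bumps \<open>\<rho>\<^sub>p\<close> subordinate to a cover of bounded multiplicity.
  The correlation of two encounters at times \<open>m\<close> and \<open>m + l\<close> becomes, by equivariance of the fiber
  measures (\<open>fiber_integral_equivariant\<close>), the sum over \<open>p\<close> and \<open>q\<close> of the \<open>P\<close>-integrals of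
  \<open>(\<integral> \<rho>\<^sub>p (\<rho>\<^sub>q \<circ> T\<^sub>\<omega>\<^sup>l) d\<mu>\<^sub>\<omega>)\<^sup>2\<close>. Mixing along the fibers factorizes the inner integral. The outcome is a
  product of two values, at \<open>\<omega>\<close> and at \<open>\<theta>\<^sup>l \<omega>\<close>, of one function on the base; this function is Lipschitz
  because \<open>\<mu>\<^sub>\<omega>\<close> is Lipschitz in \<open>\<omega>\<close>, so mixing of \<open>\<theta>\<close> decorrelates the two values
  (\<open>visit_decorrelation\<close>).

  The errors are polynomial in \<open>1/r\<close> and in the cover size, times a stretched exponential in \<open>l\<close>. Hence
  it is enough to inspect the orbits at the multiples of \<open>L = r\<^sup>-\<^sup>\<epsilon>\<close>, at the cost of an arbitrarily small
  loss in the exponent (\<open>no_visit_prob\<close>). Along \<open>r = r\<^sub>0/2^k\<close> the cover size is geometric in \<open>k\<close>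
  (\<open>dyadic_covers\<close>), so the probabilities of no encounter are summable; by Borel--Cantelli almost
  every pair has an encounter at all small dyadic scales (\<open>close_returns\<close>), and the intermediate
  times follow by monotonicity (\<open>liminf_log_min\<close>).
\<close>

section \<open>Second moment method\<close>

text \<open>
  The second moment method: a sum with mean \<open>N H\<close> vanishes only where it deviates from its mean
  by \<open>N H\<close>, and Chebyshev's inequality applies. Since \<open>0 \<le> V \<le> C\<close>, the diagonal terms of the
  second moment are at most \<open>C H\<close>, while off the diagonal only the error \<open>\<delta>\<close> is left after
  subtracting the square of the mean.
\<close>

lemma (in prob_space) second_moment_no_visit:
  fixes V :: "nat \<Rightarrow> 'a \<Rightarrow> real"
  assumes meas [measurable]: "\<And>j. V j \<in> borel_measurable M"
    and nonneg: "\<And>j z. 0 \<le> V j z" and bound: "\<And>j z. V j z \<le> C"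
    and mean: "\<And>j. expectation (V j) = H"
    and correl: "\<And>i j. i < j \<Longrightarrow> expectation (\<lambda>z. V i z * V j z) \<le> H\<^sup>2 + \<delta>"
    and pos: "0 < H" "0 < N" "0 \<le> \<delta>"
  shows "prob {z \<in> space M. \<forall>j<N. V j z = 0} \<le> C / (real N * H) + \<delta> / H\<^sup>2"
proof -
  define S where "S z = (\<Sum>j<N. V j z)" for z
  have C: "0 \<le> C" using nonneg[of 0 undefined] bound[of 0 undefined] by linarith
  have intV: "integrable M (V j)" for j
    by (rule integrable_const_bound[of _ C]) (use nonneg bound in \<open>auto simp: abs_of_nonneg\<close>)
  have intVV: "integrable M (\<lambda>z. V i z * V j z)" for i j
    by (rule integrable_const_bound[of _ "C * C"])
       (use nonneg bound in \<open>auto simp: abs_mult abs_of_nonneg C intro!: mult_mono AE_I2\<close>)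
  have S2: "(S z)\<^sup>2 = (\<Sum>i<N. \<Sum>j<N. V i z * V j z)" for z
    by (simp add: S_def power2_eq_square sum_product)
  have intS2: "integrable M (\<lambda>z. (S z)\<^sup>2)"
    unfolding S2 by (intro Bochner_Integration.integrable_sum intVV)
  have intS: "integrable M S"
    unfolding S_def[abs_def] by (intro Bochner_Integration.integrable_sum intV)
  have ES: "expectation S = N * H"
    unfolding S_def[abs_def] by (subst Bochner_Integration.integral_sum) (auto simp: intV mean)
  have pair: "expectation (\<lambda>z. V i z * V j z) \<le> H\<^sup>2 + \<delta> + (if j = i then C * H else 0)" for i j
  proof (cases i j rule: linorder_cases)
    case equal
    have "expectation (\<lambda>z. V i z * V j z) \<le> expectation (\<lambda>z. C * V i z)"
      unfolding equal by (intro integral_mono intVV integrable_mult_right intV mult_right_mono bound nonneg)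
    then show ?thesis using mean[of i] pos equal by (simp add: add_increasing)
  next
    case less
    then show ?thesis using correl[of i j] by simp
  next
    case greater
    then show ?thesis using correl[of j i] by (simp add: mult.commute)
  qed
  have "expectation (\<lambda>z. (S z)\<^sup>2) = (\<Sum>i<N. \<Sum>j<N. expectation (\<lambda>z. V i z * V j z))"
    unfolding S2 by (simp add: Bochner_Integration.integral_sum Bochner_Integration.integrable_sum intVV)
  also have "\<dots> \<le> (\<Sum>i<N. \<Sum>j<N. H\<^sup>2 + \<delta> + (if j = i then C * H else 0))"
    by (intro sum_mono pair)
  also have "\<dots> = real N ^ 2 * (H\<^sup>2 + \<delta>) + N * (C * H)"
    by (simp add: sum.distrib sum.delta power2_eq_square algebra_simps)
  finally have var: "variance S \<le> real N ^ 2 * \<delta> + N * (C * H)"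
    using variance_eq[OF intS intS2] by (simp add: ES algebra_simps power2_eq_square)
  have sub: "{z \<in> space M. \<forall>j<N. V j z = 0} \<subseteq> {z \<in> space M. \<bar>S z - expectation S\<bar> \<ge> N * H}"
    using pos by (auto simp: S_def ES abs_mult)
  have "prob {z \<in> space M. \<forall>j<N. V j z = 0} \<le> prob {z \<in> space M. \<bar>S z - expectation S\<bar> \<ge> N * H}"
    by (rule finite_measure_mono[OF sub]) (auto simp: S_def[abs_def])
  also have "\<dots> \<le> variance S / (N * H)\<^sup>2"
    by (rule Chebyshev_inequality) (use pos intS intS2 in auto)
  also have "\<dots> \<le> (real N ^ 2 * \<delta> + N * (C * H)) / (N * H)\<^sup>2"
    by (intro divide_right_mono var) simp
  also have "\<dots> = C / (real N * H) + \<delta> / H\<^sup>2"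
    using pos by (simp add: field_simps power2_eq_square)
  finally show ?thesis .
qed

section \<open>The Lipschitz norm\<close>

text \<open>
  The supremum and the infimum in the norm are taken in the conditionally complete order of the
  reals, so they carry information only once boundedness and nonemptiness have been supplied.
\<close>

lemma lip_norm_le:
  fixes f :: "'a::metric_space \<Rightarrow> real"
  assumes "\<And>x. \<bar>f x\<bar> \<le> B" "L-lipschitz_on UNIV f"
  shows "lip_norm f \<le> B + L" "0 \<le> lip_norm f"
proof -
  have "Inf {L. L-lipschitz_on UNIV f} \<le> L"
    by (rule cInf_lower) (use assms in \<open>auto intro!: bdd_belowI[of _ 0] lipschitz_on_nonneg\<close>)
  moreover have "(SUP x. \<bar>f x\<bar>) \<le> B"
    by (rule cSUP_least) (use assms in auto)
  ultimately show "lip_norm f \<le> B + L" by (simp add: lip_norm_def)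
  have "0 \<le> Inf {L. L-lipschitz_on UNIV f}"
    by (rule cInf_greatest) (use assms in \<open>auto intro: lipschitz_on_nonneg\<close>)
  moreover have "\<bar>f undefined\<bar> \<le> (SUP x. \<bar>f x\<bar>)"
    by (rule cSUP_upper) (use assms in \<open>auto intro!: bdd_aboveI2[of _ _ B]\<close>)
  ultimately show "0 \<le> lip_norm f" by (simp add: lip_norm_def)
qed

lemma lip_norm_nonneg:
  assumes "compact (UNIV :: 'a::metric_space set)" "lipschitz_fun (f :: 'a \<Rightarrow> real)"
  shows "0 \<le> lip_norm f"
proof -
  from assms(2) obtain L where L: "L-lipschitz_on UNIV f" by (auto simp: lipschitz_fun_def)
  have "compact (range f)"
    by (rule compact_continuous_image[OF lipschitz_on_continuous_on[OF L] assms(1)])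
  then obtain B where "\<And>x. \<bar>f x\<bar> \<le> B"
    using compact_imp_bounded[of "range f"] by (auto simp: bounded_iff)
  from lip_norm_le(2)[OF this L] show ?thesis .
qed

lemma lipschitz_borel_measurable:
  "L-lipschitz_on UNIV f \<Longrightarrow> f \<in> borel_measurable borel" for f :: "'a::metric_space \<Rightarrow> real"
  by (intro borel_measurable_continuous_onI lipschitz_on_continuous_on)

section \<open>Iterates of the skew product and equivariance of the fiber measures\<close>

context random_dynamical_system
begin

definition skew :: "'w \<times> 'x \<Rightarrow> 'w \<times> 'x" where
  "skew = (\<lambda>(\<omega>, x). (\<theta> \<omega>, T \<omega> x))"

lemma skew_funpow: "(skew ^^ n) (\<omega>, x) = ((\<theta> ^^ n) \<omega>, fiber_iter \<theta> T n \<omega> x)"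
  by (induction n) (auto simp: skew_def)

lemma fiber_iter_add:
  "fiber_iter \<theta> T (m + n) \<omega> x = fiber_iter \<theta> T n ((\<theta> ^^ m) \<omega>) (fiber_iter \<theta> T m \<omega> x)"
proof -
  have "(skew ^^ (n + m)) (\<omega>, x) = (skew ^^ n) ((skew ^^ m) (\<omega>, x))"
    by (simp add: funpow_add)
  then show ?thesis by (simp add: skew_funpow add.commute)
qed

lemma measurable_skew_funpow [measurable]:
  "skew ^^ n \<in> borel \<Otimes>\<^sub>M borel \<rightarrow>\<^sub>M borel \<Otimes>\<^sub>M borel"
proof (induction n)
  case (Suc n)
  have "skew \<in> borel \<Otimes>\<^sub>M borel \<rightarrow>\<^sub>M borel \<Otimes>\<^sub>M borel"
    using measurable_skew by (simp add: skew_def)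
  from measurable_comp[OF Suc this] show ?case by (simp add: comp_def)
qed (simp add: id_def)

lemma measurable_fiber_iter_joint:
  "(\<lambda>(\<omega>, x). fiber_iter \<theta> T n \<omega> x) \<in> borel \<Otimes>\<^sub>M borel \<rightarrow>\<^sub>M borel"
proof -
  have "(\<lambda>z. snd ((skew ^^ n) z)) \<in> borel \<Otimes>\<^sub>M borel \<rightarrow>\<^sub>M borel" by measurable
  moreover have "(\<lambda>z. snd ((skew ^^ n) z)) = (\<lambda>(\<omega>, x). fiber_iter \<theta> T n \<omega> x)"
    by (auto simp: skew_funpow)
  ultimately show ?thesis by simp
qed

lemma measurable_fiber_iter_compose [measurable (raw)]:
  assumes "f \<in> M \<rightarrow>\<^sub>M borel" "g \<in> M \<rightarrow>\<^sub>M borel"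
  shows "(\<lambda>z. fiber_iter \<theta> T n (f z) (g z)) \<in> M \<rightarrow>\<^sub>M borel"
  using measurable_compose[OF measurable_Pair[OF assms] measurable_fiber_iter_joint[of n]] by simp

lemma measurable_theta_funpow [measurable]: "\<theta> ^^ n \<in> borel \<rightarrow>\<^sub>M borel"
  by (induction n) (auto intro: measurable_compose measurable_base simp: id_def)

lemma measurable_theta_funpow_inv: "inv (\<theta> ^^ n) \<in> borel \<rightarrow>\<^sub>M borel"
proof (induction n)
  case (Suc n)
  have "inv (\<theta> ^^ Suc n) = inv (\<theta> ^^ n) \<circ> inv \<theta>"
    using bij_base by (simp add: o_inv_distrib bij_fn)
  then show ?case using Suc by (metis measurable_comp measurable_base_inv)
qed (simp add: id_def[symmetric] measurable_ident_sets)

lemma space_base [simp]: "space P = UNIV"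
  using sets_eq_imp_space_eq[OF sets_base] by simp

lemma space_skew [simp]: "space \<nu> = UNIV"
  using sets_eq_imp_space_eq[OF sets_skew] by (simp add: space_pair_measure)

declare sets_base [measurable_cong] sets_skew [measurable_cong]

lemma sets_fiber [simp, measurable_cong]: "sets (\<mu> \<omega>) = sets borel"
  and prob_fiber: "prob_space (\<mu> \<omega>)"
  using measurable_space[OF kernel, of \<omega>] by (auto simp: space_prob_algebra)

lemma space_fiber [simp]: "space (\<mu> \<omega>) = UNIV"
  using sets_eq_imp_space_eq[OF sets_fiber] by simp

lemma kernel_subprob [measurable]: "\<mu> \<in> borel \<rightarrow>\<^sub>M subprob_algebra borel"
  using kernel by (rule measurable_prob_algebraD)

lemma invariant_base_funpow: "distr P P (\<theta> ^^ n) = P"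
proof (induction n)
  case (Suc n)
  have "distr P P (\<theta> \<circ> \<theta> ^^ n) = distr (distr P P (\<theta> ^^ n)) P \<theta>"
    by (subst distr_distr) (auto intro: measurable_base simp: measurable_cong_sets[OF sets_base sets_base])
  then show ?case using Suc invariant_base by (simp add: comp_def)
qed (simp add: id_def)

lemma invariant_skew_funpow: "distr \<nu> \<nu> (skew ^^ n) = \<nu>"
proof (induction n)
  case (Suc n)
  have "distr \<nu> \<nu> (skew \<circ> skew ^^ n) = distr (distr \<nu> \<nu> (skew ^^ n)) \<nu> skew"
    using measurable_skew_funpow[of n] measurable_skew_funpow[of 1]
    by (subst distr_distr) (auto simp: measurable_cong_sets[OF sets_skew sets_skew])
  moreover have "distr \<nu> \<nu> skew = \<nu>" using invariant_skew by (simp add: skew_def)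
  ultimately show ?case using Suc by (simp add: comp_def)
qed (simp add: id_def)

lemma integral_base_invariant:
  fixes f :: "'w \<Rightarrow> real"
  assumes [measurable]: "f \<in> borel_measurable borel"
  shows "(\<integral>\<omega>. f ((\<theta> ^^ n) \<omega>) \<partial>P) = (\<integral>\<omega>. f \<omega> \<partial>P)"
  by (subst (2) invariant_base_funpow[of n, symmetric], subst integral_distr)
     (auto simp: measurable_cong_sets[OF sets_base sets_base])

lemma measurable_fiber_nn_integral:
  fixes F :: "'w \<times> 'x \<Rightarrow> ennreal"
  assumes [measurable]: "F \<in> borel_measurable (borel \<Otimes>\<^sub>M borel)"
  shows "(\<lambda>\<omega>. \<integral>\<^sup>+x. F (\<omega>, x) \<partial>\<mu> \<omega>) \<in> borel_measurable borel"
  using nn_integral_measurable_subprob_algebra2[OF _ kernel_subprob, of "curry F"]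
  by (simp add: curry_def)

lemma measurable_fiber_integral:
  fixes F :: "'w \<times> 'x \<Rightarrow> real"
  assumes F [measurable]: "F \<in> borel_measurable (borel \<Otimes>\<^sub>M borel)"
  shows "(\<lambda>\<omega>. \<integral>x. F (\<omega>, x) \<partial>\<mu> \<omega>) \<in> borel_measurable borel"
proof -
  have "(\<lambda>\<omega>. integral\<^sup>L (distr (\<mu> \<omega>) (borel \<Otimes>\<^sub>M borel) (Pair \<omega>)) F) \<in> borel_measurable borel"
    by (rule measurable_compose[OF measurable_distr2[OF _ kernel_subprob]
          integral_measurable_subprob_algebra[OF F]]) simp
  then show ?thesis
    by (subst (asm) integral_distr) (auto simp: measurable_Pair1')
qed

text \<open>
  This is \<open>(T\<^sub>\<omega>\<^sup>n)\<^sub>* \<mu>\<^sub>\<omega> = \<mu>\<close> over \<open>\<theta>\<^sup>n \<omega>\<close>, tested against one observable at a time. Both sides are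
  densities with respect to \<open>P\<close>. Integrated over a base set \<open>A\<close>, they agree by invariance of \<open>\<nu>\<close>,
  provided that \<open>A\<close> is a preimage under \<open>\<theta>\<^sup>n\<close>; invertibility of \<open>\<theta>\<close> makes every \<open>A\<close> of that kind.
  With the observable fixed, the exceptional null set may depend on it; only countably many
  observables enter the proof.
\<close>

lemma fiber_nn_integral_equivariant:
  fixes F :: "'w \<times> 'x \<Rightarrow> ennreal"
  assumes F [measurable]: "F \<in> borel_measurable (borel \<Otimes>\<^sub>M borel)"
  shows "AE \<omega> in P. (\<integral>\<^sup>+x. F ((\<theta> ^^ n) \<omega>, fiber_iter \<theta> T n \<omega> x) \<partial>\<mu> \<omega>)
           = (\<integral>\<^sup>+x. F ((\<theta> ^^ n) \<omega>, x) \<partial>\<mu> ((\<theta> ^^ n) \<omega>))"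
proof -
  interpret P: prob_space P by (rule prob_base)
  note mF = measurable_fiber_nn_integral[OF F]
  have FS: "(\<lambda>z. F ((skew ^^ n) z)) \<in> borel_measurable (borel \<Otimes>\<^sub>M borel)" by measurable
  note mFS = measurable_fiber_nn_integral[OF FS, unfolded skew_funpow]
  show ?thesis
  proof (rule P.density_unique2)
    fix A assume "A \<in> sets P"
    then have A [measurable]: "A \<in> sets borel" by (simp add: sets_base)
    define A' where "A' = inv (\<theta> ^^ n) -` A"
    have A' [measurable]: "A' \<in> sets borel"
      using measurable_sets[OF measurable_theta_funpow_inv A] by (simp add: A'_def)
    have A'_iff: "(\<theta> ^^ n) \<omega> \<in> A' \<longleftrightarrow> \<omega> \<in> A" for \<omega>
      using bij_fn[OF bij_base, of n] by (simp add: A'_def inv_f_f bij_is_inj)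
    have "(\<integral>\<^sup>+\<omega>\<in>A. (\<integral>\<^sup>+x. F ((\<theta> ^^ n) \<omega>, fiber_iter \<theta> T n \<omega> x) \<partial>\<mu> \<omega>) \<partial>P)
        = (\<integral>\<^sup>+\<omega>. (\<integral>\<^sup>+x. (F ((skew ^^ n) (\<omega>, x)) * indicator A (fst (\<omega>, x))) \<partial>\<mu> \<omega>) \<partial>P)"
      by (intro nn_integral_cong) (simp add: skew_funpow nn_integral_multc)
    also have "\<dots> = (\<integral>\<^sup>+z. F ((skew ^^ n) z) * indicator A (fst z) \<partial>\<nu>)"
      by (subst disintegration) auto
    also have "\<dots> = (\<integral>\<^sup>+z. F ((skew ^^ n) z) * indicator A' (fst ((skew ^^ n) z)) \<partial>\<nu>)"
      by (intro nn_integral_cong) (auto simp: skew_funpow A'_iff indicator_def split: prod.splits)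
    also have "\<dots> = (\<integral>\<^sup>+z. F z * indicator A' (fst z) \<partial>distr \<nu> \<nu> (skew ^^ n))"
      by (subst nn_integral_distr) (auto simp: measurable_cong_sets[OF sets_skew sets_skew])
    also have "\<dots> = (\<integral>\<^sup>+\<omega>. (\<integral>\<^sup>+x. F (\<omega>, x) \<partial>\<mu> \<omega>) * indicator A' \<omega> \<partial>P)"
      by (simp add: invariant_skew_funpow, subst disintegration) (auto simp: nn_integral_multc)
    also have "\<dots> = (\<integral>\<^sup>+\<omega>. (\<integral>\<^sup>+x. F (\<omega>, x) \<partial>\<mu> \<omega>) * indicator A' \<omega> \<partial>distr P P (\<theta> ^^ n))"
      by (simp add: invariant_base_funpow)
    also have "\<dots> = (\<integral>\<^sup>+\<omega>\<in>A. (\<integral>\<^sup>+x. F ((\<theta> ^^ n) \<omega>, x) \<partial>\<mu> ((\<theta> ^^ n) \<omega>)) \<partial>P)"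
      using mF by (subst nn_integral_distr)
        (auto simp: A'_iff indicator_def measurable_cong_sets[OF sets_base sets_base] intro!: nn_integral_cong)
    finally show "(\<integral>\<^sup>+\<omega>\<in>A. (\<integral>\<^sup>+x. F ((\<theta> ^^ n) \<omega>, fiber_iter \<theta> T n \<omega> x) \<partial>\<mu> \<omega>) \<partial>P)
        = (\<integral>\<^sup>+\<omega>\<in>A. (\<integral>\<^sup>+x. F ((\<theta> ^^ n) \<omega>, x) \<partial>\<mu> ((\<theta> ^^ n) \<omega>)) \<partial>P)" .
  next
    show "(\<lambda>\<omega>. \<integral>\<^sup>+x. F ((\<theta> ^^ n) \<omega>, x) \<partial>\<mu> ((\<theta> ^^ n) \<omega>)) \<in> borel_measurable P"
      using measurable_compose[OF measurable_theta_funpow mF] by simp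
  qed (use mFS in simp)
qed

lemma fiber_integral_equivariant:
  fixes F :: "'w \<times> 'x \<Rightarrow> real"
  assumes F [measurable]: "F \<in> borel_measurable (borel \<Otimes>\<^sub>M borel)"
    and nonneg: "\<And>z. 0 \<le> F z" 
  shows "AE \<omega> in P. (\<integral>x. F ((\<theta> ^^ n) \<omega>, fiber_iter \<theta> T n \<omega> x) \<partial>\<mu> \<omega>)
           = (\<integral>x. F ((\<theta> ^^ n) \<omega>, x) \<partial>\<mu> ((\<theta> ^^ n) \<omega>))"
proof -
  have "(\<lambda>z. F ((skew ^^ n) z)) \<in> borel_measurable (borel \<Otimes>\<^sub>M borel)" by measurable
  from measurable_compose[OF measurable_Pair1' this]
  have "(\<lambda>x. F ((\<theta> ^^ n) \<omega>, fiber_iter \<theta> T n \<omega> x)) \<in> borel_measurable (\<mu> \<omega>)" for \<omega>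
    by (simp add: skew_funpow)
  moreover have "(\<lambda>x. F (\<omega>, x)) \<in> borel_measurable (\<mu> \<omega>')" for \<omega> \<omega>'
    using measurable_compose[OF measurable_Pair1' F] by simp
  moreover have "AE \<omega> in P. (\<integral>\<^sup>+x. ennreal (F ((\<theta> ^^ n) \<omega>, fiber_iter \<theta> T n \<omega> x)) \<partial>\<mu> \<omega>)
           = (\<integral>\<^sup>+x. ennreal (F ((\<theta> ^^ n) \<omega>, x)) \<partial>\<mu> ((\<theta> ^^ n) \<omega>))"
    by (rule fiber_nn_integral_equivariant) simp
  ultimately show ?thesis
    by (elim AE_mp, intro AE_I2) (simp add: integral_eq_nn_integral nonneg)
qed

section \<open>The law of two independent points in a common random fiber\<close>

text \<open>
  The measure \<open>P(d\<omega>) \<mu>\<^sub>\<omega>(dx) \<mu>\<^sub>\<omega>(dy)\<close>. A property holds almost everywhere for it exactly when it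
  has the quenched form of the theorem, so that moments need only be computed after averaging over
  the base.
\<close>

definition pair_fibers :: "('w \<times> 'x \<times> 'x) measure" where
  "pair_fibers = P \<bind> (\<lambda>\<omega>. distr (\<mu> \<omega> \<Otimes>\<^sub>M \<mu> \<omega>) (borel \<Otimes>\<^sub>M (borel \<Otimes>\<^sub>M borel)) (Pair \<omega>))"

lemma pair_fibers_kernel_prob:
  "(\<lambda>\<omega>. distr (\<mu> \<omega> \<Otimes>\<^sub>M \<mu> \<omega>) (borel \<Otimes>\<^sub>M (borel \<Otimes>\<^sub>M borel)) (Pair \<omega>))
     \<in> P \<rightarrow>\<^sub>M prob_algebra (borel \<Otimes>\<^sub>M (borel \<Otimes>\<^sub>M borel))"
proof -
  have [measurable]: "\<mu> \<in> borel \<rightarrow>\<^sub>M prob_algebra borel" by (rule kernel)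
  show ?thesis by measurable
qed

lemma pair_fibers_kernel:
  "(\<lambda>\<omega>. distr (\<mu> \<omega> \<Otimes>\<^sub>M \<mu> \<omega>) (borel \<Otimes>\<^sub>M (borel \<Otimes>\<^sub>M borel)) (Pair \<omega>))
     \<in> P \<rightarrow>\<^sub>M subprob_algebra (borel \<Otimes>\<^sub>M (borel \<Otimes>\<^sub>M borel))"
  by (rule measurable_prob_algebraD[OF pair_fibers_kernel_prob])

lemma prob_pair_fibers: "prob_space pair_fibers"
  unfolding pair_fibers_def
  using measurable_space[OF pair_fibers_kernel_prob]
  by (intro prob_space.prob_space_bind[OF prob_base _ pair_fibers_kernel] AE_I2) (auto simp: space_prob_algebra)

lemma sets_pair_fibers [measurable_cong]:
  "sets pair_fibers = sets (borel \<Otimes>\<^sub>M (borel \<Otimes>\<^sub>M borel))"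
  unfolding pair_fibers_def by (rule sets_bind) auto

lemma measurable_Pair_fibers [measurable]:
  "Pair \<omega> \<in> (\<mu> \<omega> \<Otimes>\<^sub>M \<mu> \<omega>) \<rightarrow>\<^sub>M (borel \<Otimes>\<^sub>M (borel \<Otimes>\<^sub>M borel))"
  by (subst measurable_cong_sets[OF sets_pair_measure_cong[OF sets_fiber sets_fiber] refl])
     (rule measurable_Pair1', simp)

lemma AE_pair_fibers:
  assumes "Measurable.pred (borel \<Otimes>\<^sub>M (borel \<Otimes>\<^sub>M borel)) R"
  shows "(AE z in pair_fibers. R z) \<longleftrightarrow> (AE \<omega> in P. AE z in \<mu> \<omega> \<Otimes>\<^sub>M \<mu> \<omega>. R (\<omega>, z))"
  unfolding pair_fibers_def AE_bind[OF pair_fibers_kernel assms]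
  using assms by (subst AE_distr_iff) (auto simp: pred_def)

lemma expectation_pair_fibers_product:
  fixes u v :: "'w \<times> 'x \<Rightarrow> real"
  assumes u [measurable]: "u \<in> borel_measurable (borel \<Otimes>\<^sub>M borel)"
    and v [measurable]: "v \<in> borel_measurable (borel \<Otimes>\<^sub>M borel)"
    and bu: "\<And>z. \<bar>u z\<bar> \<le> B" and bv: "\<And>z. \<bar>v z\<bar> \<le> B"
  shows "(\<integral>(\<omega>, x, y). u (\<omega>, x) * v (\<omega>, y) \<partial>pair_fibers)
           = (\<integral>\<omega>. (\<integral>x. u (\<omega>, x) \<partial>\<mu> \<omega>) * (\<integral>x. v (\<omega>, x) \<partial>\<mu> \<omega>) \<partial>P)"
    and "integrable pair_fibers (\<lambda>(\<omega>, x, y). u (\<omega>, x) * v (\<omega>, y))"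
proof -
  let ?f = "\<lambda>(\<omega>, x, y). u (\<omega>, x) * v (\<omega>, y)"
  have B: "0 \<le> B" using bu[of undefined] by linarith
  have f [measurable]: "?f \<in> borel_measurable (borel \<Otimes>\<^sub>M (borel \<Otimes>\<^sub>M borel))" by measurable
  have bf: "\<bar>?f z\<bar> \<le> B * B" for z
    by (auto simp: abs_mult B intro!: mult_mono bu bv split: prod.splits)
  interpret base: prob_space P by (rule prob_base)
  have "AE \<omega> in P. emeasure (distr (\<mu> \<omega> \<Otimes>\<^sub>M \<mu> \<omega>) (borel \<Otimes>\<^sub>M (borel \<Otimes>\<^sub>M borel)) (Pair \<omega>))
       (space (distr (\<mu> \<omega> \<Otimes>\<^sub>M \<mu> \<omega>) (borel \<Otimes>\<^sub>M (borel \<Otimes>\<^sub>M borel)) (Pair \<omega>))) \<le> ennreal 1"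
    using measurable_space[OF pair_fibers_kernel_prob]
    by (intro AE_I2) (simp add: space_prob_algebra prob_space.emeasure_space_1 del: space_distr)
  note bind = f bf pair_fibers_kernel base.finite_measure_axioms this
  show "integrable pair_fibers ?f"
    unfolding pair_fibers_def by (rule integrable_bind[OF bind])
  have "(\<integral>z. ?f z \<partial>pair_fibers)
      = (\<integral>\<omega>. (\<integral>z. ?f z \<partial>distr (\<mu> \<omega> \<Otimes>\<^sub>M \<mu> \<omega>) (borel \<Otimes>\<^sub>M (borel \<Otimes>\<^sub>M borel)) (Pair \<omega>)) \<partial>P)"
    unfolding pair_fibers_def by (rule integral_bind[OF bind])
  also have "\<dots> = (\<integral>\<omega>. (\<integral>x. u (\<omega>, x) \<partial>\<mu> \<omega>) * (\<integral>x. v (\<omega>, x) \<partial>\<mu> \<omega>) \<partial>P)"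
  proof (rule Bochner_Integration.integral_cong[OF refl])
    fix \<omega>
    interpret pair_prob_space "\<mu> \<omega>" "\<mu> \<omega>"
      by (simp add: pair_prob_space_def pair_sigma_finite_def prob_fiber prob_space_imp_sigma_finite)
    have [measurable]: "(\<lambda>x. u (\<omega>, x)) \<in> borel_measurable borel"
        "(\<lambda>x. v (\<omega>, x)) \<in> borel_measurable borel"
      using measurable_compose[OF measurable_Pair1' u] measurable_compose[OF measurable_Pair1' v] by simp_all
    have "integrable (\<mu> \<omega> \<Otimes>\<^sub>M \<mu> \<omega>) (\<lambda>(x, y). u (\<omega>, x) * v (\<omega>, y))"
      by (rule P.integrable_const_bound[of _ "B * B"])
         (use bf[of "(\<omega>, _)"] in \<open>auto split: prod.splits\<close>)
    from integral_fst'[OF this]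
    show "(\<integral>z. ?f z \<partial>distr (\<mu> \<omega> \<Otimes>\<^sub>M \<mu> \<omega>) (borel \<Otimes>\<^sub>M (borel \<Otimes>\<^sub>M borel)) (Pair \<omega>))
        = (\<integral>x. u (\<omega>, x) \<partial>\<mu> \<omega>) * (\<integral>x. v (\<omega>, x) \<partial>\<mu> \<omega>)"
      by (subst integral_distr) (simp_all add: case_prod_beta')
  qed
  finally show "(\<integral>z. ?f z \<partial>pair_fibers) = (\<integral>\<omega>. (\<integral>x. u (\<omega>, x) \<partial>\<mu> \<omega>) * (\<integral>x. v (\<omega>, x) \<partial>\<mu> \<omega>) \<partial>P)" .
qed

section \<open>Smoothed counting of close encounters\<close>

text \<open>
  A finite family of Lipschitz bumps \<open>\<rho>\<^sub>p\<close> replaces the indicator of \<open>{d(x, y) < r}\<close> by the weight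
  \<open>\<Sum>\<^sub>p \<rho>\<^sub>p(x) \<rho>\<^sub>p(y)\<close>. Its terms are products, so their integrals over \<open>\<mu>\<^sub>\<omega> \<Otimes> \<mu>\<^sub>\<omega>\<close> are squares of
  integrals over \<open>\<mu>\<^sub>\<omega>\<close>, to which mixing along the fibers applies.
\<close>

context
  fixes \<rho> :: "nat \<Rightarrow> 'x \<Rightarrow> real" and I :: "nat set" and \<Lambda> :: real
  assumes bump_nonneg: "\<And>p x. 0 \<le> \<rho> p x" and bump_le1: "\<And>p x. \<rho> p x \<le> 1"
    and bump_lipschitz: "\<And>p. \<Lambda>-lipschitz_on UNIV (\<rho> p)"
begin

definition bump_mean :: "nat \<Rightarrow> 'w \<Rightarrow> real" where
  "bump_mean p \<omega> = (\<integral>x. \<rho> p x \<partial>\<mu> \<omega>)"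

text \<open>
  The integral of the weight over \<open>\<mu>\<^sub>\<omega> \<Otimes> \<mu>\<^sub>\<omega>\<close>: a smooth version of
  \<open>\<integral> \<mu>\<^sub>\<omega>(B(x, r)) d\<mu>\<^sub>\<omega>(x)\<close>.
\<close>

definition fiber_correlation :: "'w \<Rightarrow> real" where
  "fiber_correlation \<omega> = (\<Sum>p\<in>I. (bump_mean p \<omega>)\<^sup>2)"

definition close_weight :: "'x \<Rightarrow> 'x \<Rightarrow> real" where
  "close_weight x y = (\<Sum>p\<in>I. \<rho> p x * \<rho> p y)"

lemma bump_measurable [measurable]: "\<rho> p \<in> borel_measurable borel"
  by (rule lipschitz_borel_measurable[OF bump_lipschitz])

lemma bump_iter_measurable [measurable]:
  "(\<lambda>z. \<rho> p (fiber_iter \<theta> T n (fst z) (snd z))) \<in> borel_measurable (borel \<Otimes>\<^sub>M borel)"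
  by measurable

lemma bump_abs: "\<bar>\<rho> p x\<bar> \<le> 1"
  using bump_nonneg[of p x] bump_le1[of p x] by simp

lemma bump_lip_norm: "lip_norm (\<rho> p) \<le> 1 + \<Lambda>" "0 \<le> lip_norm (\<rho> p)" "lipschitz_fun (\<rho> p)"
  using lip_norm_le[OF bump_abs bump_lipschitz] bump_lipschitz
  by (auto simp: lipschitz_fun_def)

lemma Lambda_nonneg: "0 \<le> \<Lambda>"
  by (rule lipschitz_on_nonneg[OF bump_lipschitz[of 0]])

lemma fiber_integral_01:
  assumes [measurable]: "f \<in> borel_measurable borel" and "\<And>x. 0 \<le> f x" "\<And>x. f x \<le> 1"
  shows "0 \<le> (\<integral>x. f x \<partial>\<mu> \<omega>)" "(\<integral>x. f x \<partial>\<mu> \<omega>) \<le> (1 :: real)"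
proof -
  interpret F: prob_space "\<mu> \<omega>" by (rule prob_fiber)
  show "0 \<le> (\<integral>x. f x \<partial>\<mu> \<omega>)" using assms by simp
  have "integrable (\<mu> \<omega>) f"
    by (rule F.integrable_const_bound[of _ 1]) (use assms in auto)
  then show "(\<integral>x. f x \<partial>\<mu> \<omega>) \<le> 1"
    by (rule F.integral_le_const) (use assms in auto)
qed

lemma bump_mean_01: "0 \<le> bump_mean p \<omega>" "bump_mean p \<omega> \<le> 1"
  unfolding bump_mean_def
  by (rule fiber_integral_01[OF bump_measurable bump_nonneg bump_le1])+

lemma bump_mean_measurable [measurable]: "bump_mean p \<in> borel_measurable borel"
  unfolding bump_mean_def[abs_def]
  using measurable_fiber_integral[of "\<lambda>z. \<rho> p (snd z)"] by simp

lemma fiber_correlation_measurable [measurable]: "fiber_correlation \<in> borel_measurable borel"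
  unfolding fiber_correlation_def[abs_def] by measurable

lemma fiber_correlation_nonneg: "0 \<le> fiber_correlation \<omega>"
  by (simp add: fiber_correlation_def sum_nonneg)

lemma fiber_correlation_le: "fiber_correlation \<omega> \<le> card I"
proof -
  have "fiber_correlation \<omega> \<le> (\<Sum>p\<in>I. 1)"
    unfolding fiber_correlation_def
    by (intro sum_mono power_le_one bump_mean_01)
  then show ?thesis by simp
qed

lemma fiber_correlation_integrable: "integrable P fiber_correlation"
proof -
  interpret base: prob_space P by (rule prob_base)
  show ?thesis
    by (rule base.integrable_const_bound[of _ "card I"])
       (use fiber_correlation_nonneg fiber_correlation_le in \<open>auto simp: abs_of_nonneg\<close>)
qed

text \<open>
  The functions at time \<open>m\<close> are not Lipschitz in the initial point. Equivariance of the fiber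
  measures moves time \<open>m\<close> to time \<open>0\<close> and invariance of \<open>P\<close> then removes the shift of the base point;
  what remains depends only on the time difference \<open>l\<close> and has the shape required by mixing along
  the fibers.
\<close>

lemma bump_product_expectation:
  "(\<integral>(\<omega>, x, y). (\<rho> p (fiber_iter \<theta> T m \<omega> x) * \<rho> q (fiber_iter \<theta> T (m + l) \<omega> x))
       * (\<rho> p (fiber_iter \<theta> T m \<omega> y) * \<rho> q (fiber_iter \<theta> T (m + l) \<omega> y)) \<partial>pair_fibers)
     = (\<integral>\<omega>. (\<integral>x. \<rho> p x * \<rho> q (fiber_iter \<theta> T l \<omega> x) \<partial>\<mu> \<omega>)\<^sup>2 \<partial>P)" (is "?L = ?R")
  "integrable pair_fibers (\<lambda>(\<omega>, x, y). (\<rho> p (fiber_iter \<theta> T m \<omega> x) * \<rho> q (fiber_iter \<theta> T (m + l) \<omega> x))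
       * (\<rho> p (fiber_iter \<theta> T m \<omega> y) * \<rho> q (fiber_iter \<theta> T (m + l) \<omega> y)))" (is ?int)
proof -
  let ?u = "\<lambda>z. \<rho> p (fiber_iter \<theta> T m (fst z) (snd z)) * \<rho> q (fiber_iter \<theta> T (m + l) (fst z) (snd z))"
  define F where "F = (\<lambda>z. \<rho> p (snd z) * \<rho> q (fiber_iter \<theta> T l (fst z) (snd z)))"
  have u: "?u \<in> borel_measurable (borel \<Otimes>\<^sub>M borel)"
    by measurable
  have F: "F \<in> borel_measurable (borel \<Otimes>\<^sub>M borel)"
    unfolding F_def by measurable
  have F_nonneg: "0 \<le> F z" for z
    by (auto simp: F_def bump_nonneg split: prod.splits)
  have u_bound: "\<bar>?u z\<bar> \<le> 1" for z
    by (auto simp: abs_mult intro!: mult_le_one bump_abs split: prod.splits)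
  note prod = expectation_pair_fibers_product[OF u u u_bound u_bound]
  have uF: "F ((\<theta> ^^ m) \<omega>, fiber_iter \<theta> T m \<omega> x)
      = \<rho> p (fiber_iter \<theta> T m \<omega> x) * \<rho> q (fiber_iter \<theta> T (m + l) \<omega> x)" for \<omega> x
    by (simp add: F_def fiber_iter_add)
  show ?int using prod(2) by simp
  have m1: "(\<lambda>\<omega>. \<integral>x. F (\<omega>, x) \<partial>\<mu> \<omega>) \<in> borel_measurable borel"
    by (rule measurable_fiber_integral[OF F])
  have m2: "(\<lambda>\<omega>. \<integral>x. ?u (\<omega>, x) \<partial>\<mu> \<omega>) \<in> borel_measurable borel"
    by (rule measurable_fiber_integral[OF u])
  have "?L = (\<integral>\<omega>. (\<integral>x. ?u (\<omega>, x) \<partial>\<mu> \<omega>)\<^sup>2 \<partial>P)"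
    using prod(1) by (simp add: power2_eq_square)
  also have "\<dots> = (\<integral>\<omega>. (\<integral>x. F ((\<theta> ^^ m) \<omega>, x) \<partial>\<mu> ((\<theta> ^^ m) \<omega>))\<^sup>2 \<partial>P)"
  proof (rule integral_cong_AE)
    show "(\<lambda>\<omega>. (\<integral>x. ?u (\<omega>, x) \<partial>\<mu> \<omega>)\<^sup>2) \<in> borel_measurable P"
      using m2 by simp
    show "(\<lambda>\<omega>. (\<integral>x. F ((\<theta> ^^ m) \<omega>, x) \<partial>\<mu> ((\<theta> ^^ m) \<omega>))\<^sup>2) \<in> borel_measurable P"
      using measurable_compose[OF measurable_theta_funpow m1] by simp
    show "AE \<omega> in P. (\<integral>x. ?u (\<omega>, x) \<partial>\<mu> \<omega>)\<^sup>2
        = (\<integral>x. F ((\<theta> ^^ m) \<omega>, x) \<partial>\<mu> ((\<theta> ^^ m) \<omega>))\<^sup>2"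
      using fiber_integral_equivariant[OF F F_nonneg, of m] by (auto simp: uF elim!: eventually_mono)
  qed
  also have "\<dots> = (\<integral>\<omega>. (\<integral>x. F (\<omega>, x) \<partial>\<mu> \<omega>)\<^sup>2 \<partial>P)"
    using m1 by (intro integral_base_invariant) simp
  finally show "?L = ?R" by (simp add: F_def)
qed

definition visit :: "nat \<Rightarrow> 'w \<times> 'x \<times> 'x \<Rightarrow> real" where
  "visit n = (\<lambda>(\<omega>, x, y). close_weight (fiber_iter \<theta> T n \<omega> x) (fiber_iter \<theta> T n \<omega> y))"

lemma visit_measurable [measurable]:
  "visit n \<in> borel_measurable (borel \<Otimes>\<^sub>M (borel \<Otimes>\<^sub>M borel))"
  unfolding visit_def close_weight_def by measurable

lemma visit_nonneg: "0 \<le> visit n z"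
  by (auto simp: visit_def close_weight_def bump_nonneg intro!: sum_nonneg split: prod.splits)

lemma visit_le:
  assumes "\<And>x. (\<Sum>p\<in>I. \<rho> p x) \<le> C"
  shows "visit n z \<le> C"
proof -
  obtain \<omega> x y where z: "z = (\<omega>, x, y)" by (cases z)
  have "visit n z \<le> (\<Sum>p\<in>I. \<rho> p (fiber_iter \<theta> T n \<omega> x))"
    unfolding visit_def close_weight_def z
    by (auto intro!: sum_mono mult_left_le bump_le1 bump_nonneg)
  also have "\<dots> \<le> C" by (rule assms)
  finally show ?thesis .
qed

lemma visit_expectation: "(\<integral>z. visit n z \<partial>pair_fibers) = (\<integral>\<omega>. fiber_correlation \<omega> \<partial>P)"
proof -
  note A = expectation_pair_fibers_product[OF bump_iter_measurable bump_iter_measurable, of _ n 1 _ n]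
  have bnd: "\<bar>\<rho> p (fiber_iter \<theta> T n (fst z) (snd z))\<bar> \<le> 1" for z p
    by (rule bump_abs)
  have AE: "AE \<omega> in P. (\<integral>x. \<rho> p (fiber_iter \<theta> T n \<omega> x) \<partial>\<mu> \<omega>) = bump_mean p ((\<theta> ^^ n) \<omega>)" for p
    using fiber_integral_equivariant[of "\<lambda>z. \<rho> p (snd z)" n] by (simp add: bump_nonneg bump_mean_def)
  have m: "(\<lambda>\<omega>. \<integral>x. \<rho> p (fiber_iter \<theta> T n \<omega> x) \<partial>\<mu> \<omega>) \<in> borel_measurable borel" for p
    using measurable_fiber_integral[OF bump_iter_measurable, of p n] by simp
  interpret base: prob_space P by (rule prob_base)
  have one: "(\<integral>(\<omega>, x, y). \<rho> p (fiber_iter \<theta> T n \<omega> x) * \<rho> p (fiber_iter \<theta> T n \<omega> y) \<partial>pair_fibers)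
      = (\<integral>\<omega>. (bump_mean p \<omega>)\<^sup>2 \<partial>P)" for p
  proof -
    have "(\<integral>(\<omega>, x, y). \<rho> p (fiber_iter \<theta> T n \<omega> x) * \<rho> p (fiber_iter \<theta> T n \<omega> y) \<partial>pair_fibers)
      = (\<integral>\<omega>. (\<integral>x. \<rho> p (fiber_iter \<theta> T n \<omega> x) \<partial>\<mu> \<omega>)\<^sup>2 \<partial>P)"
      using A(1)[OF bnd bnd, of p p] by (simp add: power2_eq_square)
    also have "\<dots> = (\<integral>\<omega>. (bump_mean p ((\<theta> ^^ n) \<omega>))\<^sup>2 \<partial>P)"
      using AE[of p] m[of p] measurable_compose[OF measurable_theta_funpow[of n] bump_mean_measurable[of p]]
      by (intro integral_cong_AE) auto
    also have "\<dots> = (\<integral>\<omega>. (bump_mean p \<omega>)\<^sup>2 \<partial>P)"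
      by (intro integral_base_invariant) measurable
    finally show ?thesis .
  qed
  have int: "integrable P (\<lambda>\<omega>. (bump_mean p \<omega>)\<^sup>2)" for p
    by (rule base.integrable_const_bound[of _ 1]) (auto intro!: power_le_one bump_mean_01)
  have "(\<integral>z. visit n z \<partial>pair_fibers)
      = (\<integral>z. (\<Sum>p\<in>I. case z of (\<omega>, x, y) \<Rightarrow> \<rho> p (fiber_iter \<theta> T n \<omega> x) * \<rho> p (fiber_iter \<theta> T n \<omega> y)) \<partial>pair_fibers)"
    by (simp add: visit_def close_weight_def case_prod_unfold)
  also have "\<dots> = (\<Sum>p\<in>I. \<integral>\<omega>. (bump_mean p \<omega>)\<^sup>2 \<partial>P)"
    using A(2)[OF bnd bnd] by (subst Bochner_Integration.integral_sum) (auto simp: one)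
  also have "\<dots> = (\<integral>\<omega>. fiber_correlation \<omega> \<partial>P)"
    unfolding fiber_correlation_def[abs_def] by (subst Bochner_Integration.integral_sum) (auto simp: int)
  finally show ?thesis .
qed

lemma visit_correlation:
  "(\<integral>z. visit m z * visit (m + l) z \<partial>pair_fibers)
     = (\<integral>\<omega>. (\<Sum>p\<in>I. \<Sum>q\<in>I. (\<integral>x. \<rho> p x * \<rho> q (fiber_iter \<theta> T l \<omega> x) \<partial>\<mu> \<omega>)\<^sup>2) \<partial>P)"
proof -
  let ?g = "\<lambda>p q (\<omega>, x, y). (\<rho> p (fiber_iter \<theta> T m \<omega> x) * \<rho> q (fiber_iter \<theta> T (m + l) \<omega> x))
       * (\<rho> p (fiber_iter \<theta> T m \<omega> y) * \<rho> q (fiber_iter \<theta> T (m + l) \<omega> y))"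
  have expand: "visit m z * visit (m + l) z = (\<Sum>p\<in>I. \<Sum>q\<in>I. ?g p q z)" for z
    by (cases z) (simp add: visit_def close_weight_def sum_product mult_ac)
  interpret base: prob_space P by (rule prob_base)
  have F: "(\<lambda>z. \<rho> p (snd z) * \<rho> q (fiber_iter \<theta> T l (fst z) (snd z))) \<in> borel_measurable (borel \<Otimes>\<^sub>M borel)" for p q
    by measurable
  have m: "(\<lambda>\<omega>. \<integral>x. \<rho> p x * \<rho> q (fiber_iter \<theta> T l \<omega> x) \<partial>\<mu> \<omega>) \<in> borel_measurable borel" for p q
    using measurable_fiber_integral[OF F] by simp
  have int: "integrable P (\<lambda>\<omega>. (\<integral>x. \<rho> p x * \<rho> q (fiber_iter \<theta> T l \<omega> x) \<partial>\<mu> \<omega>)\<^sup>2)" for p q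
  proof (rule base.integrable_const_bound[of _ 1])
    show "AE \<omega> in P. norm ((\<integral>x. \<rho> p x * \<rho> q (fiber_iter \<theta> T l \<omega> x) \<partial>\<mu> \<omega>)\<^sup>2) \<le> 1"
      by (auto intro!: power_le_one fiber_integral_01 mult_le_one bump_nonneg bump_le1
          mult_nonneg_nonneg)
  qed (use m in simp)
  show ?thesis
    unfolding expand
    by (simp add: Bochner_Integration.integral_sum Bochner_Integration.integrable_sum
        bump_product_expectation int)
qed

text \<open>
  The rate of close encounters at time \<open>n\<close> is \<open>fiber_correlation\<close> at \<open>\<theta>\<^sup>n \<omega>\<close>. Lipschitz dependence of
  the fiber measures turns it into a Lipschitz observable of the base, so that the mixing of \<open>\<theta>\<close>
  controls its correlations in time.
\<close>

lemma fiber_correlation_lipschitz: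
  assumes C1: "\<And>f \<omega> \<omega>'. lipschitz_fun f \<Longrightarrow>
      \<bar>(\<integral>x. f x \<partial>\<mu> \<omega>) - (\<integral>x. f x \<partial>\<mu> \<omega>')\<bar> \<le> C1 * lip_norm f * dist \<omega> \<omega>'"
    and "0 < C1"
  shows "(card I * (2 * C1 * (1 + \<Lambda>)))-lipschitz_on UNIV fiber_correlation"
proof (rule lipschitz_onI)
  fix \<omega> \<omega>'
  have each: "\<bar>(bump_mean p \<omega>)\<^sup>2 - (bump_mean p \<omega>')\<^sup>2\<bar> \<le> 2 * C1 * (1 + \<Lambda>) * dist \<omega> \<omega>'" for p
  proof -
    have "\<bar>bump_mean p \<omega> - bump_mean p \<omega>'\<bar> \<le> C1 * lip_norm (\<rho> p) * dist \<omega> \<omega>'"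
      unfolding bump_mean_def by (rule C1[OF bump_lip_norm(3)])
    also have "\<dots> \<le> C1 * (1 + \<Lambda>) * dist \<omega> \<omega>'"
      using assms(2) by (intro mult_right_mono mult_left_mono bump_lip_norm) auto
    finally have d: "\<bar>bump_mean p \<omega> - bump_mean p \<omega>'\<bar> \<le> C1 * (1 + \<Lambda>) * dist \<omega> \<omega>'" .
    have "\<bar>(bump_mean p \<omega>)\<^sup>2 - (bump_mean p \<omega>')\<^sup>2\<bar>
        = \<bar>bump_mean p \<omega> - bump_mean p \<omega>'\<bar> * \<bar>bump_mean p \<omega> + bump_mean p \<omega>'\<bar>"
      by (simp add: abs_mult[symmetric] power2_eq_square algebra_simps)
    also have "\<dots> \<le> C1 * (1 + \<Lambda>) * dist \<omega> \<omega>' * 2"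
      using bump_mean_01[of p \<omega>] bump_mean_01[of p \<omega>'] d by (intro mult_mono) auto
    finally show ?thesis by (simp add: algebra_simps)
  qed
  have "dist (fiber_correlation \<omega>) (fiber_correlation \<omega>')
      = \<bar>\<Sum>p\<in>I. (bump_mean p \<omega>)\<^sup>2 - (bump_mean p \<omega>')\<^sup>2\<bar>"
    by (simp add: dist_real_def fiber_correlation_def sum_subtractf)
  also have "\<dots> \<le> (\<Sum>p\<in>I. 2 * C1 * (1 + \<Lambda>) * dist \<omega> \<omega>')"
    by (rule order_trans[OF sum_abs]) (intro sum_mono each)
  finally show "dist (fiber_correlation \<omega>) (fiber_correlation \<omega>') \<le> card I * (2 * C1 * (1 + \<Lambda>)) * dist \<omega> \<omega>'"
    by (simp add: mult_ac)
qed (use assms(2) Lambda_nonneg in simp)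

text \<open>
  Two mixing properties are used in succession. Mixing along the fiber factorizes
  \<open>\<integral> \<rho>\<^sub>p (\<rho>\<^sub>q \<circ> T\<^sub>\<omega>\<^sup>l) d\<mu>\<^sub>\<omega>\<close>, with an error for each pair \<open>(p, q)\<close>; summing the squares of the products over
  \<open>p\<close> and \<open>q\<close> gives the product of \<open>fiber_correlation\<close> at \<open>\<omega>\<close> and at \<open>\<theta>\<^sup>l \<omega>\<close>. Mixing of the base then
  decorrelates these two values. Both errors cost a factor \<open>(card I)\<^sup>2 (1 + \<Lambda>)\<^sup>2\<close>.
\<close>

lemma visit_decorrelation:
  assumes C1: "\<And>f \<omega> \<omega>'. lipschitz_fun f \<Longrightarrow>
      \<bar>(\<integral>x. f x \<partial>\<mu> \<omega>) - (\<integral>x. f x \<partial>\<mu> \<omega>')\<bar> \<le> C1 * lip_norm f * dist \<omega> \<omega>'"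
    and C1_pos: "0 < C1"
    and mix_base: "\<And>f g. lipschitz_fun f \<Longrightarrow> lipschitz_fun g \<Longrightarrow>
      \<bar>(\<integral>\<omega>. f \<omega> * g ((\<theta> ^^ l) \<omega>) \<partial>P) - (\<integral>\<omega>. f \<omega> \<partial>P) * (\<integral>\<omega>. g \<omega> \<partial>P)\<bar>
        \<le> e2 * lip_norm f * lip_norm g"
    and mix_fiber: "\<And>f g \<omega>. lipschitz_fun f \<Longrightarrow> lipschitz_fun g \<Longrightarrow>
      \<bar>(\<integral>x. f x * g (fiber_iter \<theta> T l \<omega> x) \<partial>\<mu> \<omega>)
          - (\<integral>x. f x \<partial>\<mu> \<omega>) * (\<integral>x. g x \<partial>\<mu> ((\<theta> ^^ l) \<omega>))\<bar> \<le> e3 * lip_norm f * lip_norm g"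
    and e: "0 \<le> e2" "0 \<le> e3"
  shows "(\<integral>z. visit m z * visit (m + l) z \<partial>pair_fibers) \<le> (\<integral>\<omega>. fiber_correlation \<omega> \<partial>P)\<^sup>2
      + (2 * e3 + e2 * (1 + 2 * C1)\<^sup>2) * (real (card I))\<^sup>2 * (1 + \<Lambda>)\<^sup>2"
proof -
  interpret base: prob_space P by (rule prob_base)
  define E where "E = 2 * e3 * (1 + \<Lambda>)\<^sup>2"
  have err: "\<bar>(\<integral>x. \<rho> p x * \<rho> q (fiber_iter \<theta> T l \<omega> x) \<partial>\<mu> \<omega>) - bump_mean p \<omega> * bump_mean q ((\<theta> ^^ l) \<omega>)\<bar>
      \<le> e3 * (1 + \<Lambda>)\<^sup>2" for p q \<omega>
  proof -
    have "\<bar>(\<integral>x. \<rho> p x * \<rho> q (fiber_iter \<theta> T l \<omega> x) \<partial>\<mu> \<omega>) - bump_mean p \<omega> * bump_mean q ((\<theta> ^^ l) \<omega>)\<bar>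
      \<le> e3 * lip_norm (\<rho> p) * lip_norm (\<rho> q)"
      unfolding bump_mean_def by (intro mix_fiber bump_lip_norm)
    also have "\<dots> \<le> e3 * (1 + \<Lambda>) * (1 + \<Lambda>)"
      using e Lambda_nonneg by (intro mult_mono bump_lip_norm mult_left_mono mult_nonneg_nonneg) auto
    finally show ?thesis by (simp add: power2_eq_square mult_ac)
  qed
  \<comment> \<open>Both numbers lie in the unit interval, where squaring is 2-Lipschitz.\<close>
  have square: "s\<^sup>2 \<le> t\<^sup>2 + 2 * d" if "\<bar>s - t\<bar> \<le> d" "0 \<le> s" "s \<le> 1" "0 \<le> t" "t \<le> 1" for s t d :: real
  proof -
    have "s\<^sup>2 - t\<^sup>2 = (s - t) * (s + t)" by (simp add: power2_eq_square algebra_simps)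
    also have "\<dots> \<le> d * 2" using that by (intro mult_mono) auto
    finally show ?thesis by simp
  qed
  have sq: "(\<integral>x. \<rho> p x * \<rho> q (fiber_iter \<theta> T l \<omega> x) \<partial>\<mu> \<omega>)\<^sup>2
      \<le> (bump_mean p \<omega> * bump_mean q ((\<theta> ^^ l) \<omega>))\<^sup>2 + E" for p q \<omega>
    unfolding E_def mult.assoc
    by (rule square[OF err]) (auto intro!: mult_nonneg_nonneg fiber_integral_01 mult_le_one bump_nonneg bump_le1 bump_mean_01)
  define h where "h \<omega> = fiber_correlation \<omega> * fiber_correlation ((\<theta> ^^ l) \<omega>)" for \<omega>
  have [measurable]: "h \<in> borel_measurable borel"
    unfolding h_def by measurable
  have h_bound: "0 \<le> h \<omega>" "h \<omega> \<le> card I * card I" for \<omega>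
    unfolding h_def by (auto intro!: mult_nonneg_nonneg mult_mono fiber_correlation_nonneg fiber_correlation_le)
  have int_h: "integrable P h"
    by (rule base.integrable_const_bound[of _ "card I * card I"])
       (use h_bound in \<open>auto simp: abs_of_nonneg\<close>)
  have "(\<integral>z. visit m z * visit (m + l) z \<partial>pair_fibers)
      \<le> (\<integral>\<omega>. h \<omega> + (real (card I))\<^sup>2 * E \<partial>P)"
    unfolding visit_correlation
  proof (rule integral_mono')
    fix \<omega>
    have "(\<Sum>p\<in>I. \<Sum>q\<in>I. (\<integral>x. \<rho> p x * \<rho> q (fiber_iter \<theta> T l \<omega> x) \<partial>\<mu> \<omega>)\<^sup>2)
        \<le> (\<Sum>p\<in>I. \<Sum>q\<in>I. (bump_mean p \<omega> * bump_mean q ((\<theta> ^^ l) \<omega>))\<^sup>2 + E)"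
      by (intro sum_mono sq)
    also have "\<dots> = h \<omega> + (real (card I))\<^sup>2 * E"
      by (simp add: h_def fiber_correlation_def sum_product sum.distrib power2_eq_square mult_ac)
    finally show "(\<Sum>p\<in>I. \<Sum>q\<in>I. (\<integral>x. \<rho> p x * \<rho> q (fiber_iter \<theta> T l \<omega> x) \<partial>\<mu> \<omega>)\<^sup>2)
        \<le> h \<omega> + (real (card I))\<^sup>2 * E" .
    show "0 \<le> h \<omega> + (real (card I))\<^sup>2 * E"
      using h_bound(1)[of \<omega>] e by (simp add: E_def)
  qed (use int_h in simp)
  also have "\<dots> = (\<integral>\<omega>. h \<omega> \<partial>P) + (real (card I))\<^sup>2 * E"
    using int_h base.prob_space by simp
  also have "(\<integral>\<omega>. h \<omega> \<partial>P) \<le> (\<integral>\<omega>. fiber_correlation \<omega> \<partial>P)\<^sup>2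
      + e2 * (1 + 2 * C1)\<^sup>2 * (real (card I))\<^sup>2 * (1 + \<Lambda>)\<^sup>2"
  proof -
    have lip: "lipschitz_fun fiber_correlation"
      using fiber_correlation_lipschitz[OF C1 C1_pos] by (auto simp: lipschitz_fun_def)
    have "\<bar>fiber_correlation \<omega>\<bar> \<le> card I" for \<omega>
      using fiber_correlation_nonneg[of \<omega>] fiber_correlation_le[of \<omega>] by simp
    note n = lip_norm_le[OF this fiber_correlation_lipschitz[OF C1 C1_pos]]
    have "card I + card I * (2 * C1 * (1 + \<Lambda>)) \<le> (1 + 2 * C1) * card I * (1 + \<Lambda>)"
      using Lambda_nonneg by (simp add: algebra_simps)
    with n have n': "lip_norm fiber_correlation \<le> (1 + 2 * C1) * card I * (1 + \<Lambda>)" by linarith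
    have "(\<integral>\<omega>. h \<omega> \<partial>P) \<le> (\<integral>\<omega>. fiber_correlation \<omega> \<partial>P)\<^sup>2 + e2 * lip_norm fiber_correlation * lip_norm fiber_correlation"
      using mix_base[OF lip lip] by (simp add: h_def power2_eq_square)
    also have "e2 * lip_norm fiber_correlation * lip_norm fiber_correlation
        \<le> e2 * ((1 + 2 * C1) * card I * (1 + \<Lambda>)) * ((1 + 2 * C1) * card I * (1 + \<Lambda>))"
      using e n n' C1_pos Lambda_nonneg by (intro mult_mono mult_left_mono mult_nonneg_nonneg) auto
    finally show ?thesis by (simp add: power2_eq_square mult_ac)
  qed
  finally show ?thesis by (simp add: E_def algebra_simps)
qed

text \<open>
  The orbits are inspected only at the \<open>N\<close> multiples of \<open>L\<close>. Any two inspection times are then at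
  distance at least \<open>L\<close>, so mixing applies to every off-diagonal pair. Thinning out the times can only
  make an encounter less likely, which is harmless for an upper bound on the probability of having
  none.
\<close>

lemma no_visit_prob:
  assumes C1: "\<And>f \<omega> \<omega>'. lipschitz_fun f \<Longrightarrow>
      \<bar>(\<integral>x. f x \<partial>\<mu> \<omega>) - (\<integral>x. f x \<partial>\<mu> \<omega>')\<bar> \<le> C1 * lip_norm f * dist \<omega> \<omega>'"
    and C1_pos: "0 < C1"
    and mix_base: "\<And>f g l. L \<le> l \<Longrightarrow> lipschitz_fun f \<Longrightarrow> lipschitz_fun g \<Longrightarrow>
      \<bar>(\<integral>\<omega>. f \<omega> * g ((\<theta> ^^ l) \<omega>) \<partial>P) - (\<integral>\<omega>. f \<omega> \<partial>P) * (\<integral>\<omega>. g \<omega> \<partial>P)\<bar>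
        \<le> e2 * lip_norm f * lip_norm g"
    and mix_fiber: "\<And>f g \<omega> l. L \<le> l \<Longrightarrow> lipschitz_fun f \<Longrightarrow> lipschitz_fun g \<Longrightarrow>
      \<bar>(\<integral>x. f x * g (fiber_iter \<theta> T l \<omega> x) \<partial>\<mu> \<omega>)
          - (\<integral>x. f x \<partial>\<mu> \<omega>) * (\<integral>x. g x \<partial>\<mu> ((\<theta> ^^ l) \<omega>))\<bar> \<le> e3 * lip_norm f * lip_norm g"
    and e: "0 \<le> e2" "0 \<le> e3"
    and mult: "\<And>x. (\<Sum>p\<in>I. \<rho> p x) \<le> C"
    and H: "0 < H" "H \<le> (\<integral>\<omega>. fiber_correlation \<omega> \<partial>P)" and N: "0 < N"
  shows "measure pair_fibers {z. \<forall>j<N. visit (j * L) z = 0} \<le> C / (real N * H)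
      + (2 * e3 + e2 * (1 + 2 * C1)\<^sup>2) * (real (card I))\<^sup>2 * (1 + \<Lambda>)\<^sup>2 / H\<^sup>2"
proof -
  interpret pairs: prob_space pair_fibers by (rule prob_pair_fibers)
  define \<delta> where "\<delta> = (2 * e3 + e2 * (1 + 2 * C1)\<^sup>2) * (real (card I))\<^sup>2 * (1 + \<Lambda>)\<^sup>2"
  define J where "J = (\<integral>\<omega>. fiber_correlation \<omega> \<partial>P)"
  have \<delta>: "0 \<le> \<delta>" unfolding \<delta>_def using e by simp
  have C: "0 \<le> C" using mult[of undefined] bump_nonneg by (meson order_trans sum_nonneg)
  have space: "space pair_fibers = UNIV"
    using sets_eq_imp_space_eq[OF sets_pair_fibers] by (simp add: space_pair_measure)
  have "pairs.prob {z \<in> space pair_fibers. \<forall>j<N. visit (j * L) z = 0} \<le> C / (real N * J) + \<delta> / J\<^sup>2"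
  proof (rule pairs.second_moment_no_visit)
    fix i j :: nat assume "i < j"
    then obtain k where j: "j = i + Suc k" using less_imp_Suc_add by auto
    then have eq: "j * L = i * L + Suc k * L" and le: "L \<le> Suc k * L" by (auto simp: algebra_simps)
    show "(\<integral>z. visit (i * L) z * visit (j * L) z \<partial>pair_fibers) \<le> J\<^sup>2 + \<delta>"
      unfolding eq \<delta>_def J_def
      by (rule visit_decorrelation[OF C1 C1_pos mix_base[OF le] mix_fiber[OF le] e])
  qed (use H N \<delta> in \<open>auto simp: J_def visit_nonneg visit_le[OF mult] visit_expectation\<close>)
  also have "\<dots> \<le> C / (real N * H) + \<delta> / H\<^sup>2"
    using H N C \<delta> by (intro add_mono divide_left_mono power_mono mult_left_mono mult_pos_pos) (auto simp: J_def)
  finally show ?thesis by (simp add: space \<delta>_def)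
qed

end

end

section \<open>Bumps and covers of bounded multiplicity\<close>

text \<open>
  Equal to \<open>1\<close> on \<open>B(c, 2r)\<close>, so that a point of \<open>B(c, r)\<close> and any point at distance less than \<open>r\<close>
  from it are both counted with full weight, and supported in \<open>B(c, 4r)\<close>, the ball whose multiplicity
  is bounded.
\<close>

definition bump :: "'a::metric_space \<Rightarrow> real \<Rightarrow> 'a \<Rightarrow> real" where
  "bump c r x = max 0 (min 1 (2 - dist c x / (2 * r)))"

lemma bump_range: "0 \<le> bump c r x" "bump c r x \<le> 1"
  by (auto simp: bump_def)

lemma bump_eq_1: "0 < r \<Longrightarrow> dist c x \<le> 2 * r \<Longrightarrow> bump c r x = 1"
  by (simp add: bump_def field_simps)

lemma bump_pos_imp_ball: "0 < r \<Longrightarrow> bump c r x \<noteq> 0 \<Longrightarrow> x \<in> ball c (4 * r)"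
  by (rule ccontr) (simp add: bump_def field_simps)

lemma bump_is_lipschitz:
  assumes "0 < r"
  shows "(1 / (2 * r))-lipschitz_on UNIV (bump c r)"
proof (rule lipschitz_onI)
  fix x y :: 'a
  have "\<bar>bump c r x - bump c r y\<bar> \<le> \<bar>dist c x / (2 * r) - dist c y / (2 * r)\<bar>"
    unfolding bump_def by linarith
  also have "\<dots> = \<bar>dist c x - dist c y\<bar> / (2 * r)"
    using assms by (simp add: diff_divide_distrib[symmetric] abs_divide)
  also have "\<dots> \<le> dist x y / (2 * r)"
  proof (rule divide_right_mono)
    show "\<bar>dist c x - dist c y\<bar> \<le> dist x y"
      using dist_triangle[of c x y] dist_triangle[of c y x] by (simp add: dist_commute)
  qed (use assms in simp)
  finally show "dist (bump c r x) (bump c r y) \<le> 1 / (2 * r) * dist x y"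
    by (simp add: dist_real_def)
qed (use assms in simp)

lemma sum_bump_le:
  assumes "0 < r" "card {p \<in> I. x \<in> ball (c p) (4 * r)} \<le> C" "finite I"
  shows "(\<Sum>p\<in>I. bump (c p) r x) \<le> real C"
proof -
  have "(\<Sum>p\<in>I. bump (c p) r x) \<le> (\<Sum>p\<in>I. if x \<in> ball (c p) (4 * r) then 1 else 0)"
  proof (rule sum_mono)
    show "bump (c p) r x \<le> (if x \<in> ball (c p) (4 * r) then 1 else 0)" for p
      using bump_pos_imp_ball[OF assms(1), of "c p" x] bump_range(2)[of "c p" r x] by force
  qed
  also have "\<dots> = real (card {p \<in> I. x \<in> ball (c p) (4 * r)})"
    using assms(3) by (simp add: sum.If_cases Int_def del: mem_ball)
  finally show ?thesis using assms(2) by linarith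
qed

text \<open>
  Along \<open>r, r/2, r/4, \<dots>\<close> the number of balls grows at most geometrically. Each center at the
  scale \<open>r/2^(k+1)\<close> lies within \<open>r/2^k\<close> of some center at the scale \<open>r/2^k\<close>, and \<open>r/2^k\<close> is less than four
  radii of the finer scale; so a coarse center is within reach of at most \<open>C\<close> fine ones. The cover size
  enters the mixing errors, where any growth slower than the stretched exponential is
  acceptable.
\<close>

lemma dyadic_covers:
  assumes "bounded_local_complexity (UNIV :: 'a::metric_space set)"
  obtains C :: nat and r :: real and \<kappa> :: "nat \<Rightarrow> nat" and c :: "nat \<Rightarrow> nat \<Rightarrow> 'a::metric_space"
  where "0 < r" "r \<le> 1" "0 < C"
    and "\<And>k. UNIV \<subseteq> (\<Union>p\<in>{1..\<kappa> k}. ball (c k p) (r / 2 ^ k))"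
    and "\<And>k x. card {p \<in> {1..\<kappa> k}. x \<in> ball (c k p) (4 * (r / 2 ^ k))} \<le> C"
    and "\<And>k. \<kappa> k \<le> \<kappa> 0 * C ^ k"
proof -
  define ok where "ok C s \<kappa> c \<longleftrightarrow> UNIV \<subseteq> (\<Union>p\<in>{1..\<kappa>}. ball (c p) s) \<and>
      (\<forall>y. card {p \<in> {1..\<kappa>}. y \<in> ball (c p) (4 * s)} \<le> C)"
    for C s and \<kappa> :: nat and c :: "nat \<Rightarrow> 'a"
  from assms obtain C0 where "\<forall>\<^sub>F s in at_right (0::real). \<exists>\<kappa> c. ok C0 s \<kappa> c"
    unfolding bounded_local_complexity_def ok_def by auto
  then obtain s0 where s0: "0 < s0" "\<And>s. 0 < s \<Longrightarrow> s < s0 \<Longrightarrow> \<exists>\<kappa> c. ok C0 s \<kappa> c"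
    unfolding eventually_at_right_field by auto
  define r where "r = min 1 (s0 / 2)"
  have r: "0 < r" "r \<le> 1" "r < s0" using s0(1) by (auto simp: r_def)
  have "\<exists>\<kappa> c. ok C0 (r / 2 ^ k) \<kappa> c" for k
  proof (rule s0(2))
    have "r / 2 ^ k \<le> r" using r by (simp add: field_simps)
    then show "r / 2 ^ k < s0" using r by simp
  qed (use r in simp)
  then obtain \<kappa> c where ok: "\<And>k. ok C0 (r / 2 ^ k) (\<kappa> k) (c k)" by metis
  define C where "C = Suc C0"
  have mult: "card {p \<in> {1..\<kappa> k}. x \<in> ball (c k p) (4 * (r / 2 ^ k))} \<le> C" for k x
    using ok[of k] unfolding ok_def C_def by (meson le_SucI)
  have step: "\<kappa> (Suc k) \<le> \<kappa> k * C" for k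
  proof -
    let ?A = "\<lambda>p. {q \<in> {1..\<kappa> (Suc k)}. c k p \<in> ball (c (Suc k) q) (4 * (r / 2 ^ Suc k))}"
    have "{1..\<kappa> (Suc k)} \<subseteq> (\<Union>p\<in>{1..\<kappa> k}. ?A p)"
    proof
      fix q assume q: "q \<in> {1..\<kappa> (Suc k)}"
      obtain p where p: "p \<in> {1..\<kappa> k}" "c (Suc k) q \<in> ball (c k p) (r / 2 ^ k)"
        using ok[of k] unfolding ok_def by blast
      moreover have "r / 2 ^ k \<le> 4 * (r / 2 ^ Suc k)" using r by (simp add: field_simps)
      ultimately have "c k p \<in> ball (c (Suc k) q) (4 * (r / 2 ^ Suc k))"
        by (simp add: dist_commute)
      then show "q \<in> (\<Union>p\<in>{1..\<kappa> k}. ?A p)" using p q by blast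
    qed
    then have "card {1..\<kappa> (Suc k)} \<le> card (\<Union>p\<in>{1..\<kappa> k}. ?A p)"
      by (intro card_mono) auto
    also have "\<dots> \<le> (\<Sum>p\<in>{1..\<kappa> k}. card (?A p))"
      by (rule card_UN_le) simp
    also have "\<dots> \<le> (\<Sum>p\<in>{1..\<kappa> k}. C)"
      by (intro sum_mono mult)
    finally show ?thesis by simp
  qed
  have "\<kappa> k \<le> \<kappa> 0 * C ^ k" for k
  proof (induction k)
    case (Suc k)
    have "\<kappa> (Suc k) \<le> \<kappa> k * C" by (rule step)
    also have "\<dots> \<le> \<kappa> 0 * C ^ k * C" by (rule mult_right_mono[OF Suc]) simp
    finally show ?case by (simp add: mult_ac)
  qed simp
  then show thesis
    using that[of r C c \<kappa>] r mult ok unfolding ok_def C_def by auto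
qed

section \<open>Rates\<close>

lemma stretched_exp_mono:
  assumes "c \<le> c'" "0 < c" "1 \<le> L" "L \<le> l"
  shows "exp (- (real l powr c')) \<le> exp (- (real L powr c))"
proof -
  have "real L powr c \<le> real l powr c" using assms by (intro powr_mono2) auto
  also have "\<dots> \<le> real l powr c'" using assms by (intro powr_mono) auto
  finally show ?thesis by simp
qed

text \<open>
  The exponential series gives \<open>exp (-y) \<le> M! / y^M\<close>; with \<open>\<beta>^M > G\<close> this beats the
  factor \<open>G^k\<close>.
\<close>

lemma summable_geometric_times_exp_geometric:
  fixes G \<beta> :: real
  assumes "0 < G" "1 < \<beta>"
  shows "summable (\<lambda>k. G ^ k * exp (- (\<beta> ^ k)))"
proof -
  obtain M where M: "G < \<beta> ^ M" using assms real_arch_pow by blast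
  have pos: "0 < \<beta> ^ n" for n using assms by simp
  have "summable (\<lambda>k. fact M * (G / \<beta> ^ M) ^ k)"
    using M assms pos[of M] by (intro summable_mult summable_geometric) (simp add: abs_of_pos)
  moreover have "norm (G ^ k * exp (- (\<beta> ^ k))) \<le> fact M * (G / \<beta> ^ M) ^ k" for k
  proof -
    have "(\<beta> ^ k) ^ M / fact M \<le> exp (\<beta> ^ k)"
    proof -
      have "(\<beta> ^ k) ^ M / fact M = (\<Sum>n\<in>{M}. (\<beta> ^ k) ^ n /\<^sub>R fact n)" by (simp add: divide_inverse)
      also have "\<dots> \<le> (\<Sum>n. (\<beta> ^ k) ^ n /\<^sub>R fact n)"
        by (rule sum_le_suminf) (use assms summable_exp_generic[of "\<beta> ^ k"] in auto)
      finally show ?thesis by (simp add: exp_def)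
    qed
    then have "exp (- (\<beta> ^ k)) \<le> fact M / (\<beta> ^ k) ^ M"
      using pos[of k] by (simp add: exp_minus field_simps)
    also have "(\<beta> ^ k) ^ M = (\<beta> ^ M) ^ k" by (simp add: power_mult[symmetric] mult.commute)
    finally have "G ^ k * exp (- (\<beta> ^ k)) \<le> G ^ k * (fact M / (\<beta> ^ M) ^ k)"
      using assms by (intro mult_left_mono) auto
    then show ?thesis using assms by (simp add: abs_mult power_divide mult_ac)
  qed
  ultimately show ?thesis by (rule summable_comparison_test'[where N = 0])
qed

text \<open>
  Passage from dyadic scales to all times: for large \<open>n\<close> the last \<open>k\<close> with \<open>5 \<cdot> 2^(b k) \<le> n\<close> leaves room
  for the index \<open>i < n\<close> (whence \<open>5\<close> in place of \<open>4\<close>), and \<open>R / 2^k\<close> is then a constant times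
  \<open>n^(-1/b)\<close>. The strict inequality \<open>b < a\<close> absorbs the constant.
\<close>

lemma liminf_log_min:
  fixes d :: "nat \<Rightarrow> real"
  assumes d: "\<And>i. 0 \<le> d i" and b: "0 < b" "b < a" and R: "0 < R"
    and close: "\<forall>\<^sub>F k in sequentially. \<exists>i. real i \<le> 4 * (2 powr b) ^ k \<and> d i < R / 2 ^ k"
  shows "ereal (1 / a) \<le> liminf (\<lambda>n. - elog (Min (d ` {..<n})) / ereal (ln (real n)))"
proof (rule Liminf_bounded)
  obtain k0 where k0: "\<And>k. k0 \<le> k \<Longrightarrow> \<exists>i. real i \<le> 4 * (2 powr b) ^ k \<and> d i < R / 2 ^ k"
    using close unfolding eventually_sequentially by auto
  define w where "w = b * ln 2"
  have w: "0 < w" using b by (simp add: w_def)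
  have ev1: "\<forall>\<^sub>F n in sequentially. (real k0 + 1) * w + ln 5 \<le> ln (real n)"
    by (rule eventually_compose_filterlim[OF eventually_ge_at_top
          filterlim_compose[OF ln_at_top filterlim_real_sequentially]])
  have "0 < 1 / b - 1 / a" using b by (simp add: field_simps)
  then have ev2: "\<forall>\<^sub>F n in sequentially.
      (ln R + ln 5 / b + ln 2) / (1 / b - 1 / a) \<le> ln (real n)"
    by (intro eventually_compose_filterlim[OF eventually_ge_at_top
          filterlim_compose[OF ln_at_top filterlim_real_sequentially]])
  show "\<forall>\<^sub>F n in sequentially. ereal (1 / a) \<le> - elog (Min (d ` {..<n})) / ereal (ln (real n))"
    using ev1 ev2 eventually_gt_at_top[of 1]
  proof eventually_elim
    case (elim n)
    define k where "k = nat \<lfloor>(ln n - ln 5) / w\<rfloor>"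
    have ln_n: "0 < ln (real n)" using elim by simp
    have ge: "real k0 + 1 \<le> (ln n - ln 5) / w" using elim(1) w by (simp add: pos_le_divide_eq)
    then have k: "real k \<le> (ln n - ln 5) / w" "(ln n - ln 5) / w - 1 \<le> real k" "k0 \<le> k"
      unfolding k_def by (auto simp: le_nat_iff le_floor_iff)
    then obtain i where i: "real i \<le> 4 * (2 powr b) ^ k" "d i < R / 2 ^ k" using k0 by blast
    have "(2 powr b) ^ k = exp (real k * w)"
      by (simp add: powr_def exp_of_nat_mult[symmetric] w_def mult_ac)
    also have "\<dots> \<le> exp (ln n - ln 5)"
      using k(1) w by (simp add: pos_le_divide_eq)
    also have "\<dots> = real n / 5" using elim by (simp add: exp_diff)
    finally have "4 * (2 powr b) ^ k < real n" using elim by simp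
    with i(1) have "i < n" by linarith
    then have m_le: "Min (d ` {..<n}) \<le> d i" by (intro Min_le) auto
    have "Min (d ` {..<n}) \<in> d ` {..<n}" using elim by (intro Min_in) (auto simp: lessThan_empty_iff)
    then have m0: "0 \<le> Min (d ` {..<n})" using d by auto
    show ?case
    proof (cases "Min (d ` {..<n}) = 0")
      case True
      then show ?thesis using ln_n by (simp add: elog_def ereal_divide)
    next
      case False
      with m0 have pos: "0 < Min (d ` {..<n})" by simp
      have "ln (Min (d ` {..<n})) \<le> ln (R / 2 ^ k)"
        using pos m_le i(2) by simp
      also have "\<dots> = ln R - real k * ln 2"
        using R by (simp add: ln_div ln_realpow)
      also have "\<dots> \<le> ln R - ((ln n - ln 5) / w - 1) * ln 2"
        using k(2) by (intro diff_left_mono mult_right_mono) auto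
      also have "\<dots> = ln R + ln 5 / b + ln 2 - ln n / b"
        using b by (simp add: w_def field_simps)
      also have "\<dots> \<le> - (ln n / a)"
        using elim(2) \<open>0 < 1 / b - 1 / a\<close> by (simp add: pos_divide_le_eq algebra_simps)
      finally have "1 / a \<le> - ln (Min (d ` {..<n})) / ln n"
        using pos_le_divide_eq[OF ln_n, of "1 / a" "- ln (Min (d ` {..<n}))"] by simp
      then show ?thesis using False ln_n by (simp add: elog_def)
    qed
  qed
qed

lemma liminf_log_min_nonneg:
  fixes d :: "nat \<Rightarrow> real"
  assumes d: "\<And>i. 0 \<le> d i" "\<And>i. d i \<le> R"
  shows "0 \<le> liminf (\<lambda>n. - elog (Min (d ` {..<n})) / ereal (ln (real n)))"
proof -
  define R' where "R' = max 1 R"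
  have "(\<lambda>n. - ln R' / ln (real n)) \<longlonglongrightarrow> 0"
    by (rule tendsto_divide_0[OF tendsto_const filterlim_at_top_imp_at_infinity[OF
          filterlim_compose[OF ln_at_top filterlim_real_sequentially]]])
  then have "(\<lambda>n. ereal (- ln R' / ln (real n))) \<longlonglongrightarrow> ereal 0" by simp
  from lim_imp_Liminf[OF trivial_limit_sequentially this]
  have "0 = liminf (\<lambda>n. ereal (- ln R' / ln (real n)))"
    by (simp only: zero_ereal_def)
  also have "\<dots> \<le> liminf (\<lambda>n. - elog (Min (d ` {..<n})) / ereal (ln (real n)))"
  proof (rule Liminf_mono)
    show "\<forall>\<^sub>F n in sequentially. ereal (- ln R' / ln (real n))
        \<le> - elog (Min (d ` {..<n})) / ereal (ln (real n))"
      using eventually_gt_at_top[of 1]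
    proof eventually_elim
      case (elim n)
      have ln_n: "0 < ln (real n)" using elim by simp
      have "Min (d ` {..<n}) \<in> d ` {..<n}" using elim by (intro Min_in) (auto simp: lessThan_empty_iff)
      then have m: "0 \<le> Min (d ` {..<n})" "Min (d ` {..<n}) \<le> R'"
        using d by (auto simp: R'_def le_max_iff_disj)
      show ?case
      proof (cases "Min (d ` {..<n}) = 0")
        case True
        then show ?thesis using ln_n by (simp add: elog_def ereal_divide)
      next
        case False
        then have "ln (Min (d ` {..<n})) \<le> ln R'" using m by simp
        then show ?thesis using False ln_n by (simp add: elog_def divide_right_mono)
      qed
    qed
  qed
  finally show ?thesis .
qed


lemma powr_of_dyadic: "0 < r \<Longrightarrow> (r / 2 ^ k) powr s = r powr s * (2 powr (- s)) ^ k" for r s :: real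
  by (simp add: powr_divide powr_realpow[symmetric] powr_powr powr_minus_divide field_simps)

lemma ceiling_power_bounds:
  fixes b :: real
  assumes "1 < b"
  shows "b ^ k \<le> real (nat \<lceil>b ^ k\<rceil>)" "real (nat \<lceil>b ^ k\<rceil>) \<le> 2 * b ^ k" "1 \<le> nat \<lceil>b ^ k\<rceil>"
proof -
  have "1 \<le> b ^ k" using assms by simp
  then show "b ^ k \<le> real (nat \<lceil>b ^ k\<rceil>)" "real (nat \<lceil>b ^ k\<rceil>) \<le> 2 * b ^ k" "1 \<le> nat \<lceil>b ^ k\<rceil>"
    by linarith+
qed

text \<open>
  The bound of \<open>no_visit_prob\<close> at the scale \<open>r/2^k\<close>, with \<open>n^k\<close> inspections, gap \<open>\<beta>^k\<close>, cover size
  \<open>\<kappa> C^k\<close>, Lipschitz constants of order \<open>2^k\<close> and encounter rate \<open>h q^k\<close>.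
\<close>

lemma summable_no_visit_bound:
  fixes h q n \<beta> c :: real
  assumes "0 < h" "0 < q" "1 < n * q" "0 < n" "1 < \<beta>" "0 < c" "0 \<le> A" "0 \<le> B" "0 \<le> \<kappa>" "0 < C"
  shows "summable (\<lambda>k. A / (n ^ k * (h * q ^ k))
      + B * exp (- ((\<beta> ^ k) powr c)) * (\<kappa> * C ^ k)\<^sup>2 * (2 ^ k)\<^sup>2 / (h * q ^ k)\<^sup>2)"
proof (rule summable_add)
  have "summable (\<lambda>k. A / h * (1 / (n * q)) ^ k)"
    using assms by (intro summable_mult summable_geometric) auto
  then show "summable (\<lambda>k. A / (n ^ k * (h * q ^ k)))"
    by (simp add: field_simps)
  have "(\<beta> ^ k) powr c = (\<beta> powr c) ^ k" for k
    using assms by (simp add: powr_realpow[symmetric] powr_powr mult.commute)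
  moreover have "summable (\<lambda>k. B * \<kappa>\<^sup>2 / h\<^sup>2 * ((C\<^sup>2 * 4 / q\<^sup>2) ^ k * exp (- ((\<beta> powr c) ^ k))))"
    using assms by (intro summable_mult summable_geometric_times_exp_geometric) auto
  moreover have "B * E * (\<kappa> * C ^ k)\<^sup>2 * (2 ^ k)\<^sup>2 / (h * q ^ k)\<^sup>2
      = B * \<kappa>\<^sup>2 / h\<^sup>2 * ((C\<^sup>2 * 4 / q\<^sup>2) ^ k * E)" for k E
  proof -
    have sq: "(t ^ k)\<^sup>2 = (t\<^sup>2) ^ k" for t :: real
      by (simp only: power_mult[symmetric] mult.commute)
    show ?thesis using sq[of 2] by (simp add: power_mult_distrib power_divide sq mult_ac)
  qed
  ultimately show "summable (\<lambda>k. B * exp (- ((\<beta> ^ k) powr c)) * (\<kappa> * C ^ k)\<^sup>2 * (2 ^ k)\<^sup>2 / (h * q ^ k)\<^sup>2)"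
    by simp
qed

section \<open>Almost sure close encounters\<close>

context random_dynamical_system
begin

definition small_ball_integral :: "real \<Rightarrow> real" where
  "small_ball_integral r = (\<integral>\<omega>. (\<integral>x. measure (\<mu> \<omega>) (ball x r) \<partial>\<mu> \<omega>) \<partial>P)"

lemma small_ball_integral_01: "0 \<le> small_ball_integral r" "small_ball_integral r \<le> 1"
proof -
  show "0 \<le> small_ball_integral r"
    unfolding small_ball_integral_def by (intro Bochner_Integration.integral_nonneg measure_nonneg)
  interpret base: prob_space P by (rule prob_base)
  have "small_ball_integral r \<le> (\<integral>\<omega>. 1 \<partial>P)"
    unfolding small_ball_integral_def
  proof (rule integral_mono')
    fix \<omega>
    interpret F: prob_space "\<mu> \<omega>" by (rule prob_fiber)
    have "(\<integral>x. measure (\<mu> \<omega>) (ball x r) \<partial>\<mu> \<omega>) \<le> (\<integral>x. 1 \<partial>\<mu> \<omega>)"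
      by (rule integral_mono') (simp_all add: F.prob_le_1)
    then show "(\<integral>x. measure (\<mu> \<omega>) (ball x r) \<partial>\<mu> \<omega>) \<le> 1" using F.prob_space by simp
  qed auto
  then show "small_ball_integral r \<le> 1" using base.prob_space by simp
qed

text \<open>
  If \<open>x \<in> B(c\<^sub>p, r)\<close>, then \<open>B(x, r) \<subseteq> B(c\<^sub>p, 2r)\<close>, so the single term \<open>p\<close> of \<open>\<Sum>\<^sub>p \<rho>\<^sub>p(x) \<integral> \<rho>\<^sub>p d\<mu>\<^sub>\<omega>\<close> is at
  least \<open>\<mu>\<^sub>\<omega>(B(x, r))\<close>. Integrating this over \<open>\<mu>\<^sub>\<omega>\<close> gives the sum of the squared means.
\<close>

lemma small_ball_integral_le_fiber_correlation:
  assumes r: "0 < r" and cover: "UNIV \<subseteq> (\<Union>p\<in>I. ball (c p) r)" and "finite I"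
  shows "small_ball_integral r \<le> (\<integral>\<omega>. fiber_correlation (\<lambda>p. bump (c p) r) I \<omega> \<partial>P)"
  unfolding small_ball_integral_def
proof (rule integral_mono')
  let ?\<rho> = "\<lambda>p. bump (c p) r"
  note bumps = bump_range bump_is_lipschitz[OF r]
  show "integrable P (fiber_correlation ?\<rho> I)" by (rule fiber_correlation_integrable[OF bumps])
  show "0 \<le> fiber_correlation ?\<rho> I \<omega>" for \<omega> by (rule fiber_correlation_nonneg[OF bumps])
  have meas [measurable]: "?\<rho> p \<in> borel_measurable borel" for p
    by (rule lipschitz_borel_measurable[OF bump_is_lipschitz[OF r]])
  fix \<omega>
  interpret F: prob_space "\<mu> \<omega>" by (rule prob_fiber)
  have int: "integrable (\<mu> \<omega>) (?\<rho> p)" for p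
    by (rule F.integrable_const_bound[of _ 1]) (auto simp: bump_range abs_of_nonneg)
  have mean_nonneg: "0 \<le> bump_mean ?\<rho> p \<omega>" for p
    by (rule bump_mean_01[OF bumps])
  have "(\<integral>x. measure (\<mu> \<omega>) (ball x r) \<partial>\<mu> \<omega>) \<le> (\<integral>x. (\<Sum>p\<in>I. ?\<rho> p x * bump_mean ?\<rho> p \<omega>) \<partial>\<mu> \<omega>)"
  proof (rule integral_mono')
    fix x
    obtain p where p: "p \<in> I" "x \<in> ball (c p) r" using cover by blast
    have one: "?\<rho> p y = 1" if "y \<in> ball x r" for y
      using p(2) that dist_triangle[of "c p" y x] by (intro bump_eq_1[OF r]) simp
    have "measure (\<mu> \<omega>) (ball x r) = (\<integral>y. indicator (ball x r) y \<partial>\<mu> \<omega>)" by simp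
    also have "\<dots> \<le> bump_mean ?\<rho> p \<omega>"
      unfolding bump_mean_def[OF bumps]
      by (rule integral_mono'[OF int]) (auto simp: indicator_def one bump_range simp del: mem_ball)
    also have "\<dots> = ?\<rho> p x * bump_mean ?\<rho> p \<omega>" using one[of x] r by simp
    also have "\<dots> \<le> (\<Sum>p\<in>I. ?\<rho> p x * bump_mean ?\<rho> p \<omega>)"
      by (intro member_le_sum mult_nonneg_nonneg bump_range mean_nonneg p(1) assms(3))
    finally show "measure (\<mu> \<omega>) (ball x r) \<le> (\<Sum>p\<in>I. ?\<rho> p x * bump_mean ?\<rho> p \<omega>)" .
    show "0 \<le> (\<Sum>p\<in>I. ?\<rho> p x * bump_mean ?\<rho> p \<omega>)"
      by (intro sum_nonneg mult_nonneg_nonneg bump_range mean_nonneg)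
  qed (use int in simp)
  also have "\<dots> = fiber_correlation ?\<rho> I \<omega>"
    using int by (simp add: fiber_correlation_def[OF bumps] bump_mean_def[OF bumps] power2_eq_square)
  finally show "(\<integral>x. measure (\<mu> \<omega>) (ball x r) \<partial>\<mu> \<omega>) \<le> fiber_correlation ?\<rho> I \<omega>" .
qed

lemma visit_imp_close:
  assumes r: "0 < r" and "visit (\<lambda>p. bump (c p) r) I n (\<omega>, x, y) \<noteq> 0"
  shows "dist (fiber_iter \<theta> T n \<omega> x) (fiber_iter \<theta> T n \<omega> y) < 8 * r"
proof -
  let ?x = "fiber_iter \<theta> T n \<omega> x" and ?y = "fiber_iter \<theta> T n \<omega> y"
  note bumps = bump_range bump_is_lipschitz[OF r]
  have "(\<Sum>p\<in>I. bump (c p) r ?x * bump (c p) r ?y) \<noteq> 0"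
    using assms(2) by (simp add: visit_def[OF bumps] close_weight_def[OF bumps])
  then obtain p where "bump (c p) r ?x * bump (c p) r ?y \<noteq> 0"
    by (rule sum.not_neutral_contains_not_neutral)
  then have "bump (c p) r ?x \<noteq> 0" "bump (c p) r ?y \<noteq> 0" by auto
  with bump_pos_imp_ball[OF r] have "?x \<in> ball (c p) (4 * r)" "?y \<in> ball (c p) (4 * r)" by blast+
  then show ?thesis using dist_triangle3[of ?x ?y "c p"] by simp
qed

text \<open>
  The exponents are chosen so that \<open>s < s + \<epsilon> < s + 2 \<epsilon> < a\<close>. At the scale \<open>r/2^k\<close> there are about
  \<open>2^((s + \<epsilon>) k)\<close> inspection times, which outnumber the inverse encounter rate \<open>2^(s k)\<close> by a geometric
  factor, and the gap between them is about \<open>2^(\<epsilon> k)\<close>, which makes the mixing errors decay faster than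
  any geometric sequence. The total time elapsed is of order \<open>2^((s + 2 \<epsilon>) k)\<close>. The probabilities of no
  encounter are summable over \<open>k\<close>, and the Borel--Cantelli lemma applies.
\<close>

lemma close_returns:
  assumes compact_fiber: "compact (UNIV :: 'x set)"
    and complexity: "bounded_local_complexity (UNIV :: 'x set)"
    and lip: "lipschitz_fiber_measures \<mu>"
    and mix_base: "mixes_stretched_exp P \<theta>"
    and mix_fiber: "mixes_stretched_exp_fibers \<theta> T \<mu>"
    and s: "0 < s" "s < a"
    and dim: "\<forall>\<^sub>F r in at_right 0. r powr s \<le> small_ball_integral r"
  obtains b R where "0 < b" "b < a" "0 < R"
    "AE \<omega> in P. AE (x, y) in \<mu> \<omega> \<Otimes>\<^sub>M \<mu> \<omega>. \<forall>\<^sub>F k in sequentially.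
       \<exists>i. real i \<le> 4 * (2 powr b) ^ k \<and>
         dist (fiber_iter \<theta> T i \<omega> x) (fiber_iter \<theta> T i \<omega> y) < R / 2 ^ k"
proof -
  obtain C1 where C1_pos: "0 < C1" and C1: "\<And>f \<omega> \<omega>'. lipschitz_fun f \<Longrightarrow>
      \<bar>(\<integral>x. f x \<partial>\<mu> \<omega>) - (\<integral>x. f x \<partial>\<mu> \<omega>')\<bar> \<le> C1 * lip_norm f * dist \<omega> \<omega>'"
    using lip unfolding lipschitz_fiber_measures_def by blast
  obtain c2 C2 where c2: "0 < c2" "0 < C2" and mix2: "\<And>f g n. lipschitz_fun f \<Longrightarrow> lipschitz_fun g \<Longrightarrow>
      \<bar>(\<integral>\<omega>. f \<omega> * g ((\<theta> ^^ n) \<omega>) \<partial>P) - (\<integral>\<omega>. f \<omega> \<partial>P) * (\<integral>\<omega>. g \<omega> \<partial>P)\<bar>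
        \<le> C2 * exp (- (real n powr c2)) * lip_norm f * lip_norm g"
    using mix_base unfolding mixes_stretched_exp_def by blast
  obtain c3 C3 where c3: "0 < c3" "0 < C3" and mix3: "\<And>f g \<omega> n. lipschitz_fun f \<Longrightarrow> lipschitz_fun g \<Longrightarrow>
      \<bar>(\<integral>x. f x * g (fiber_iter \<theta> T n \<omega> x) \<partial>\<mu> \<omega>)
          - (\<integral>x. f x \<partial>\<mu> \<omega>) * (\<integral>x. g x \<partial>\<mu> ((\<theta> ^^ n) \<omega>))\<bar>
        \<le> C3 * exp (- (real n powr c3)) * lip_norm f * lip_norm g"
    using mix_fiber unfolding mixes_stretched_exp_fibers_def by blast
  define c where "c = min c2 c3"
  have c: "0 < c" "c \<le> c2" "c \<le> c3" using c2 c3 by (auto simp: c_def)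
  obtain C :: nat and r \<kappa> and cen :: "nat \<Rightarrow> nat \<Rightarrow> 'x" where r: "0 < r" "r \<le> 1" and C: "0 < C"
    and cover: "\<And>k. UNIV \<subseteq> (\<Union>p\<in>{1..\<kappa> k}. ball (cen k p) (r / 2 ^ k))"
    and mult: "\<And>k x. card {p \<in> {1..\<kappa> k}. x \<in> ball (cen k p) (4 * (r / 2 ^ k))} \<le> C"
    and growth: "\<And>k. \<kappa> k \<le> \<kappa> 0 * C ^ k"
    by (rule dyadic_covers[OF complexity], rule that)

  define \<epsilon> where "\<epsilon> = (a - s) / 3"
  have \<epsilon>: "0 < \<epsilon>" "s + 2 * \<epsilon> < a" using s by (auto simp: \<epsilon>_def field_simps)
  define \<eta> where "\<eta> = 2 powr (s + \<epsilon>)"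
  define \<gamma> where "\<gamma> = 2 powr \<epsilon>"
  define q where "q = 2 powr (- s)"
  have rates: "1 < \<eta>" "1 < \<gamma>" "0 < q" "1 < \<eta> * q"
    using \<epsilon> s by (auto simp: \<eta>_def \<gamma>_def q_def powr_add[symmetric])
  define N where "N k = nat \<lceil>\<eta> ^ k\<rceil>" for k
  define L where "L k = nat \<lceil>\<gamma> ^ k\<rceil>" for k
  note Nb = ceiling_power_bounds[OF rates(1), folded N_def]
  note Lb = ceiling_power_bounds[OF rates(2), folded L_def]
  define rr where "rr k = r / 2 ^ k" for k :: nat
  have rr: "0 < rr k" for k using r by (simp add: rr_def)
  define \<rho> where "\<rho> k = (\<lambda>p. bump (cen k p) (rr k))" for k
  define I where "I k = {1..\<kappa> k}" for k
  define \<Lambda> where "\<Lambda> k = 1 / (2 * rr k)" for k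
  have bumps: "\<And>p x. 0 \<le> \<rho> k p x" "\<And>p x. \<rho> k p x \<le> 1"
      "\<And>p. (\<Lambda> k)-lipschitz_on UNIV (\<rho> k p)" for k
    using bump_is_lipschitz[OF rr[of k]] by (auto simp: \<rho>_def \<Lambda>_def bump_range)
  define h where "h = r powr s"
  have h: "0 < h" using r by (simp add: h_def)
  \<comment> \<open>For large \<open>k\<close>, a lower bound for the mean of \<open>fiber_correlation\<close> at the \<open>k\<close>-th scale.\<close>
  define H where "H k = h * q ^ k" for k :: nat
  have H_eq: "H k = rr k powr s" for k
    using powr_of_dyadic[OF r(1)] by (simp add: H_def h_def q_def rr_def)
  have H_pos: "0 < H k" for k using h rates by (simp add: H_def)
  define bad where "bad k = {z. \<forall>j<N k. visit (\<rho> k) (I k) (j * L k) z = 0}" for k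

  \<comment> \<open>The two exponents of mixing are replaced by their minimum \<open>c\<close>.\<close>
  have rate: "C2 * exp (- (real l powr c2)) * A * B \<le> C2 * exp (- (real (L k) powr c)) * A * B"
      "C3 * exp (- (real l powr c3)) * A * B \<le> C3 * exp (- (real (L k) powr c)) * A * B"
    if "L k \<le> l" "0 \<le> A" "0 \<le> B" for l k and A B :: real
    using stretched_exp_mono[OF c(2) c(1) Lb(3) that(1)] stretched_exp_mono[OF c(3) c(1) Lb(3) that(1)]
      c2 c3 that by (auto intro!: mult_right_mono mult_left_mono)
  define G where "G = (2 * C3 + C2 * (1 + 2 * C1)\<^sup>2) * (1 + 1 / (2 * r))\<^sup>2"
  have G: "0 \<le> G" using c2 c3 by (simp add: G_def)
  define bound where "bound k = C / (\<eta> ^ k * (h * q ^ k))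
      + G * exp (- ((\<gamma> ^ k) powr c)) * (\<kappa> 0 * real C ^ k)\<^sup>2 * (2 ^ k)\<^sup>2 / (h * q ^ k)\<^sup>2" for k
  have bad_le: "measure pair_fibers (bad k) \<le> bound k"
    if large: "rr k powr s \<le> small_ball_integral (rr k)" for k
  proof -
    define e where "e = exp (- (real (L k) powr c))"
    have e: "0 \<le> C2 * e" "0 \<le> C3 * e" using c2 c3 by (auto simp: e_def)
    have H_le: "H k \<le> (\<integral>\<omega>. fiber_correlation (\<rho> k) (I k) \<omega> \<partial>P)"
      unfolding H_eq \<rho>_def
      by (rule order_trans[OF large small_ball_integral_le_fiber_correlation[OF rr]])
         (use cover[of k] in \<open>auto simp: rr_def I_def\<close>)
    have "measure pair_fibers (bad k) \<le> C / (real (N k) * H k)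
        + (2 * (C3 * e) + C2 * e * (1 + 2 * C1)\<^sup>2) * (real (card (I k)))\<^sup>2 * (1 + \<Lambda> k)\<^sup>2 / (H k)\<^sup>2"
      unfolding bad_def
    proof (rule no_visit_prob[OF bumps C1 C1_pos _ _ e])
      show "\<bar>(\<integral>\<omega>. f \<omega> * g ((\<theta> ^^ l) \<omega>) \<partial>P) - (\<integral>\<omega>. f \<omega> \<partial>P) * (\<integral>\<omega>. g \<omega> \<partial>P)\<bar>
          \<le> C2 * e * lip_norm f * lip_norm g" if "L k \<le> l" "lipschitz_fun f" "lipschitz_fun g" for f g l
        unfolding e_def
        by (rule order_trans[OF mix2 rate(1)]) (use that lip_norm_nonneg[OF compact_base] in auto)
      show "\<bar>(\<integral>x. f x * g (fiber_iter \<theta> T l \<omega> x) \<partial>\<mu> \<omega>)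
          - (\<integral>x. f x \<partial>\<mu> \<omega>) * (\<integral>x. g x \<partial>\<mu> ((\<theta> ^^ l) \<omega>))\<bar>
          \<le> C3 * e * lip_norm f * lip_norm g" if "L k \<le> l" "lipschitz_fun f" "lipschitz_fun g" for f g \<omega> l
        unfolding e_def
        by (rule order_trans[OF mix3 rate(2)]) (use that lip_norm_nonneg[OF compact_fiber] in auto)
      show "(\<Sum>p\<in>I k. \<rho> k p x) \<le> real C" for x
        unfolding \<rho>_def by (rule sum_bump_le[OF rr]) (use mult[where k = k] in \<open>auto simp: I_def rr_def\<close>)
      show "0 < N k" using Nb(3)[of k] by simp
    qed (use H_pos H_le in auto)
    also have "\<dots> \<le> bound k"
      unfolding bound_def
    proof (rule add_mono)
      show "C / (real (N k) * H k) \<le> C / (\<eta> ^ k * (h * q ^ k))"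
        using Nb(1)[of k] Nb(3)[of k] rates H_pos[of k] h unfolding H_def
        by (intro divide_left_mono mult_right_mono mult_pos_pos) auto
      have "e \<le> exp (- ((\<gamma> ^ k) powr c))"
        using Lb(1)[of k] rates c by (auto simp: e_def intro!: powr_mono2)
      moreover have "(real (card (I k)))\<^sup>2 \<le> (\<kappa> 0 * real C ^ k)\<^sup>2"
        using growth[of k] by (intro power_mono) (simp_all add: I_def flip: of_nat_power of_nat_mult)
      moreover have "(1 + \<Lambda> k)\<^sup>2 \<le> (1 + 1 / (2 * r))\<^sup>2 * (2 ^ k)\<^sup>2"
      proof -
        have "1 + \<Lambda> k \<le> (1 + 1 / (2 * r)) * 2 ^ k"
          using r by (simp add: \<Lambda>_def rr_def field_simps)
        moreover have "0 \<le> 1 + \<Lambda> k" using rr[of k] by (simp add: \<Lambda>_def)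
        ultimately have "(1 + \<Lambda> k)\<^sup>2 \<le> ((1 + 1 / (2 * r)) * 2 ^ k)\<^sup>2" by (rule power_mono)
        then show ?thesis by (simp add: power_mult_distrib)
      qed
      moreover define g where "g = 2 * C3 + C2 * (1 + 2 * C1)\<^sup>2"
      moreover have "0 \<le> g" using c2 c3 by (simp add: g_def)
      ultimately have "g * e * (real (card (I k)))\<^sup>2 * (1 + \<Lambda> k)\<^sup>2
          \<le> g * exp (- ((\<gamma> ^ k) powr c)) * (\<kappa> 0 * real C ^ k)\<^sup>2 * ((1 + 1 / (2 * r))\<^sup>2 * (2 ^ k)\<^sup>2)"
        by (intro mult_mono mult_nonneg_nonneg) (auto simp: e_def)
      then have "g * e * (real (card (I k)))\<^sup>2 * (1 + \<Lambda> k)\<^sup>2 / (H k)\<^sup>2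
          \<le> g * exp (- ((\<gamma> ^ k) powr c)) * (\<kappa> 0 * real C ^ k)\<^sup>2 * ((1 + 1 / (2 * r))\<^sup>2 * (2 ^ k)\<^sup>2) / (H k)\<^sup>2"
        by (rule divide_right_mono) simp
      then show "(2 * (C3 * e) + C2 * e * (1 + 2 * C1)\<^sup>2) * (real (card (I k)))\<^sup>2 * (1 + \<Lambda> k)\<^sup>2 / (H k)\<^sup>2
          \<le> G * exp (- ((\<gamma> ^ k) powr c)) * (\<kappa> 0 * real C ^ k)\<^sup>2 * (2 ^ k)\<^sup>2 / (h * q ^ k)\<^sup>2"
        by (simp add: g_def G_def H_def algebra_simps)
    qed
    finally show ?thesis .
  qed
  have "filterlim rr (at_right 0) sequentially"
    unfolding filterlim_at rr_def
    using r LIMSEQ_divide_realpow_zero[of 2 r] by (auto intro!: always_eventually)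
  from eventually_compose_filterlim[OF dim this]
  have "\<forall>\<^sub>F k in sequentially. norm (measure pair_fibers (bad k)) \<le> bound k"
    by eventually_elim (use bad_le in simp)
  moreover have "summable bound"
    unfolding bound_def using rates h c G C by (intro summable_no_visit_bound) auto
  ultimately have "summable (\<lambda>k. measure pair_fibers (bad k))"
    by (rule summable_comparison_test_ev)
  interpret pairs: prob_space pair_fibers by (rule prob_pair_fibers)
  have [measurable]: "visit (\<rho> k) (I k) n \<in> borel_measurable (borel \<Otimes>\<^sub>M (borel \<Otimes>\<^sub>M borel))" for k n
    by (rule visit_measurable[OF bumps])
  have bad_eq: "bad k = {z \<in> space pair_fibers. \<forall>j<N k. visit (\<rho> k) (I k) (j * L k) z = 0}" for k
    using sets_eq_imp_space_eq[OF sets_pair_fibers] by (simp add: bad_def space_pair_measure)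
  have "AE z in pair_fibers. \<forall>\<^sub>F k in sequentially. z \<in> space pair_fibers - bad k"
  proof (rule borel_cantelli_AE1)
    show "bad k \<in> sets pair_fibers" for k unfolding bad_eq by measurable
    show "emeasure pair_fibers (bad k) < \<infinity>" for k
      by (simp add: pairs.emeasure_eq_measure)
    show "summable (\<lambda>k. measure pair_fibers (bad k))" by fact
  qed
  then have "AE z in pair_fibers. \<forall>\<^sub>F k in sequentially. \<exists>j<N k. visit (\<rho> k) (I k) (j * L k) z \<noteq> 0"
    by (rule AE_mp) (auto simp: bad_def elim!: eventually_mono intro!: AE_I2)
  then have "AE \<omega> in P. AE z in \<mu> \<omega> \<Otimes>\<^sub>M \<mu> \<omega>. \<forall>\<^sub>F k in sequentially.
      \<exists>j<N k. visit (\<rho> k) (I k) (j * L k) (\<omega>, z) \<noteq> 0"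
    by (subst (asm) AE_pair_fibers) (simp_all add: eventually_sequentially)
  then have "AE \<omega> in P. AE (x, y) in \<mu> \<omega> \<Otimes>\<^sub>M \<mu> \<omega>. \<forall>\<^sub>F k in sequentially.
       \<exists>i. real i \<le> 4 * (2 powr (s + 2 * \<epsilon>)) ^ k \<and>
         dist (fiber_iter \<theta> T i \<omega> x) (fiber_iter \<theta> T i \<omega> y) < 8 * r / 2 ^ k"
  proof (elim eventually_mono, clarify)
    fix \<omega> x y
    assume "\<forall>\<^sub>F k in sequentially. \<exists>j<N k. visit (\<rho> k) (I k) (j * L k) (\<omega>, x, y) \<noteq> 0"
    then show "\<forall>\<^sub>F k in sequentially. \<exists>i. real i \<le> 4 * (2 powr (s + 2 * \<epsilon>)) ^ k \<and>
         dist (fiber_iter \<theta> T i \<omega> x) (fiber_iter \<theta> T i \<omega> y) < 8 * r / 2 ^ k"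
    proof eventually_elim
      case (elim k)
      then obtain j where j: "j < N k" and v: "visit (\<rho> k) (I k) (j * L k) (\<omega>, x, y) \<noteq> 0" by blast
      have "dist (fiber_iter \<theta> T (j * L k) \<omega> x) (fiber_iter \<theta> T (j * L k) \<omega> y) < 8 * rr k"
        by (rule visit_imp_close[OF rr v[unfolded \<rho>_def]])
      moreover have "real (j * L k) \<le> 4 * (2 powr (s + 2 * \<epsilon>)) ^ k"
      proof -
        have "real (j * L k) \<le> real (N k) * real (L k)" using j by (simp add: mult_right_mono)
        also have "\<dots> \<le> (2 * \<eta> ^ k) * (2 * \<gamma> ^ k)"
          using Nb(2)[of k] Lb(2)[of k] rates by (intro mult_mono) auto
        also have "\<dots> = 4 * (\<eta> * \<gamma>) ^ k" by (simp add: power_mult_distrib)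
        also have "\<eta> * \<gamma> = 2 powr (s + 2 * \<epsilon>)"
          unfolding \<eta>_def \<gamma>_def powr_add[symmetric] by (simp add: algebra_simps)
        finally show ?thesis .
      qed
      ultimately show ?case
        by (intro exI[of _ "j * L k"]) (simp add: rr_def)
    qed
  qed
  with that[of "s + 2 * \<epsilon>" "8 * r"] \<epsilon> s r show thesis by auto
qed

lemma small_ball_integral_ge:
  assumes "upper_quenched_corr_dim P \<mu> < ereal s"
  shows "\<forall>\<^sub>F r in at_right 0. r powr s \<le> small_ball_integral r"
proof -
  have "\<forall>\<^sub>F r in at_right 0. elog (small_ball_integral r) / ereal (ln r) < ereal s"
    using assms unfolding upper_quenched_corr_dim_def small_ball_integral_def by (rule Limsup_lessD)
  moreover have "\<forall>\<^sub>F r in at_right 0. 0 < r \<and> r < (1::real)"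
    by (auto simp: eventually_at_right_field intro!: exI[of _ 1])
  ultimately show ?thesis
  proof eventually_elim
    case (elim r)
    then have ln_r: "ln r < 0" by simp
    have ne: "small_ball_integral r \<noteq> 0"
      using elim ln_r by (auto simp: elog_def ereal_divide)
    then have pos: "0 < small_ball_integral r" using small_ball_integral_01(1)[of r] by simp
    have "ln (small_ball_integral r) / ln r < s"
      using elim ln_r ne by (simp add: elog_def)
    then have "s * ln r < ln (small_ball_integral r)"
      using ln_r by (simp add: neg_divide_less_eq)
    then have "exp (s * ln r) < exp (ln (small_ball_integral r))" by simp
    then show ?case using pos elim by (simp add: powr_def)
  qed
qed

lemma upper_quenched_corr_dim_nonneg: "0 \<le> upper_quenched_corr_dim P \<mu>"
  unfolding upper_quenched_corr_dim_def small_ball_integral_def[symmetric]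
proof (rule le_Limsup)
  have "\<forall>\<^sub>F r in at_right 0. 0 < r \<and> r < (1::real)"
    by (auto simp: eventually_at_right_field intro!: exI[of _ 1])
  then show "\<forall>\<^sub>F r in at_right 0. 0 \<le> elog (small_ball_integral r) / ereal (ln r)"
  proof eventually_elim
    case (elim r)
    then have "ln r < 0" by simp
    then show ?case
      using small_ball_integral_01[of r] by (auto simp: elog_def divide_nonpos_neg ereal_divide)
  qed
qed simp

end

section \<open>The lower bound for the logarithmic closeness of orbits\<close>

theorem proposition1p11:
  fixes P :: "'w::metric_space measure"
    and \<theta> :: "'w \<Rightarrow> 'w"
    and T :: "'w \<Rightarrow> 'x::metric_space \<Rightarrow> 'x"
    and \<nu> :: "('w \<times> 'x) measure"
    and \<mu> :: "'w \<Rightarrow> 'x measure"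
  assumes "random_dynamical_system P \<theta> T \<nu> \<mu>"
    and "compact (UNIV :: 'x set)"
    and "bounded_local_complexity (UNIV :: 'x set)"
    and "lipschitz_fiber_measures \<mu>"
    and "mixes_stretched_exp P \<theta>"
    and "mixes_stretched_exp_fibers \<theta> T \<mu>"
  shows "AE \<omega> in P. AE (x, y) in \<mu> \<omega> \<Otimes>\<^sub>M \<mu> \<omega>.
           liminf (\<lambda>n. - elog (min_orbit_dist \<theta> T n \<omega> x y) / ereal (ln (real n)))
             \<ge> 1 / upper_quenched_corr_dim P \<mu>"
proof -
  interpret random_dynamical_system P \<theta> T \<nu> \<mu> by (rule assms(1))
  let ?D = "upper_quenched_corr_dim P \<mu>"
  let ?l = "\<lambda>\<omega> x y. liminf (\<lambda>n. - elog (min_orbit_dist \<theta> T n \<omega> x y) / ereal (ln (real n)))"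
  \<comment> \<open>Only real \<open>a\<close> above the dimension are treated directly. The dimension itself is reached
    along a sequence of such \<open>a\<close>, which keeps the exceptional sets countable in number.\<close>
  have above: "AE \<omega> in P. AE (x, y) in \<mu> \<omega> \<Otimes>\<^sub>M \<mu> \<omega>. ereal (1 / a) \<le> ?l \<omega> x y"
    if a: "?D < ereal a" for a
  proof -
    obtain s where s: "?D < ereal s" "s < a"
      using ereal_dense2[OF a] by auto
    have "0 < s" using s(1) upper_quenched_corr_dim_nonneg by (metis ereal_less(2) order_le_less_trans)
    from close_returns[OF assms(2-6) this s(2) small_ball_integral_ge[OF s(1)]]
    obtain b R where b: "0 < b" "b < a" and R: "0 < R"
      and close: "AE \<omega> in P. AE (x, y) in \<mu> \<omega> \<Otimes>\<^sub>M \<mu> \<omega>. \<forall>\<^sub>F k in sequentially.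
        \<exists>i. real i \<le> 4 * (2 powr b) ^ k \<and>
          dist (fiber_iter \<theta> T i \<omega> x) (fiber_iter \<theta> T i \<omega> y) < R / 2 ^ k"
      by blast
    show ?thesis
      using close
    proof (elim eventually_mono, clarify)
      fix \<omega> x y
      assume "\<forall>\<^sub>F k in sequentially. \<exists>i. real i \<le> 4 * (2 powr b) ^ k \<and>
          dist (fiber_iter \<theta> T i \<omega> x) (fiber_iter \<theta> T i \<omega> y) < R / 2 ^ k"
      from liminf_log_min[OF zero_le_dist b R this]
      show "ereal (1 / a) \<le> ?l \<omega> x y" by (simp add: min_orbit_dist_def)
    qed
  qed
  show ?thesis
  proof (cases "?D = \<infinity>")
    case True
    \<comment> \<open>The claimed lower bound is \<open>0\<close>, and distances are bounded.\<close>
    obtain R where R: "\<And>x y :: 'x. dist x y \<le> R"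
      using compact_imp_bounded[OF assms(2)] by (auto simp: bounded_two_points)
    have "1 / ?D \<le> ?l \<omega> x y" for \<omega> x y
      using liminf_log_min_nonneg[OF zero_le_dist R] by (simp add: True min_orbit_dist_def)
    then show ?thesis by simp
  next
    case False
    then obtain D where D: "?D = ereal D" "0 \<le> D"
      using upper_quenched_corr_dim_nonneg by (cases ?D) auto
    have "AE \<omega> in P. AE (x, y) in \<mu> \<omega> \<Otimes>\<^sub>M \<mu> \<omega>. ereal (1 / (D + 1 / Suc m)) \<le> ?l \<omega> x y" for m
      by (rule above) (simp add: D)
    then have "AE \<omega> in P. AE z in \<mu> \<omega> \<Otimes>\<^sub>M \<mu> \<omega>. \<forall>m.
        ereal (1 / (D + 1 / Suc m)) \<le> ?l \<omega> (fst z) (snd z)"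
      by (simp add: AE_all_countable case_prod_unfold)
    moreover have "1 / ?D \<le> l" if l: "\<And>m. ereal (1 / (D + 1 / Suc m)) \<le> l" for l
    proof (cases "D = 0")
      case True
      have "ereal (real m) \<le> l" for m
        by (rule order_trans[OF _ l[of m]]) (simp add: True)
      then have "l = \<infinity>" by (meson less_PInf_Ex_of_nat not_less)
      then show ?thesis by simp
    next
      case False
      have "(\<lambda>m. 1 / (D + 1 / real (Suc m))) \<longlonglongrightarrow> 1 / (D + 0)"
        using False LIMSEQ_inverse_real_of_nat
        by (intro tendsto_intros) (simp_all add: inverse_eq_divide)
      then have "(\<lambda>m. ereal (1 / (D + 1 / real (Suc m)))) \<longlonglongrightarrow> ereal (1 / D)" by simp
      from LIMSEQ_le_const2[OF this] l have "ereal (1 / D) \<le> l" by auto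
      then show ?thesis using False D by (simp add: one_ereal_def)
    qed
    ultimately show ?thesis
      by (simp add: case_prod_unfold) (elim eventually_mono, blast)
  qed
qed

end
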